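(* Let $\Omega\subset\mathbb{R}^n$ be a bounded open set with $|\Omega|=1$. Let $1<p<\infty$, $0<\theta<1$ and $1\le r<\infty$. Then $$(L^{p)}(\Omega),L^p(\Omega))_{\theta,r}=G\Gamma(p,r;w_1,w_2),$$ with equivalent (quasi-)norms, where $w_1(t)=t^{-1}(1-\log t)^{r\theta/p-1}$ and $w_2(t)=(1-\log t)^{-1}$.
   Context: $\log$ is the natural logarithm. For measurable $f:\Omega\to\mathbb{R}$, $f_*$ is the decreasing rearrangement of $|f|$ on $(0,1)$: $f_*(s)=\inf\{t\ge0:|\{x:|f(x)|>t\}|\le s\}$, and $f_*^p=(f_* )^p$. Grand Lebesgue space $L^{p)}$: measurable $f$ with $\|f\|_{L^{p)}}=\sup_{0<t<1}(1-\log t)^{-1/p}\left(\int_t^1 f_*^p(\sigma)\,d\sigma\right)^{1/p}<\infty$. Generalized Gamma space $G\Gamma(p,m;w_1,w_2)$ ($1\le p,m<\infty$): measurable $f$ with $\left[\int_0^1 w_1(t)\left(\int_0^t f_*^p(\sigma)w_2(\sigma)\,d\sigma\right)^{m/p}dt\right]^{1/m}<\infty$, equipped with this quasinorm. For a compatible couple $(X_0,X_1)$, $K(f,t;X_0,X_1)=\inf_{f=f_0+f_1}(\|f_0\|_{X_0}+t\|f_1\|_{X_1})$, and $(X_0,X_1)_{\theta,r}$ is the set of $f\in X_0+X_1$ with $\left(\int_0^1[t^{-\theta}K(f,t;X_0,X_1)]^r\frac{dt}{t}\right)^{1/r}<\infty$, equipped with this norm. Equality of spaces means equality as sets with equivalent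 quasinorms. *)

theory Defs
  imports "HOL-Analysis.Analysis"
begin

text \<open>
  Functions on a measure space \<open>M\<close> are represented by everywhere defined real functions, and
  quasinorms are \<^typ>\<open>ennreal\<close>-valued. Almost everywhere equal functions are not identified;
  instead the decompositions \<open>f = f0 + f1\<close> below are understood almost everywhere.
\<close>

record 'a quasinormed_space =
  elems :: "('a \<Rightarrow> real) set"
  qnorm :: "('a \<Rightarrow> real) \<Rightarrow> ennreal"

definition space_of_qnorm ::
    "'a measure \<Rightarrow> (('a \<Rightarrow> real) \<Rightarrow> ennreal) \<Rightarrow> 'a quasinormed_space" where
  "space_of_qnorm M N =
     \<lparr>elems = {f \<in> borel_measurable M. N f < \<infinity>}, qnorm = N\<rparr>"

definition eq_equiv_qnorms ::
    "'a quasinormed_space \<Rightarrow> 'a quasinormed_space \<Rightarrow> bool" where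
  "eq_equiv_qnorms X Y \<longleftrightarrow> elems X = elems Y \<and>
     (\<exists>c C :: real. 0 < c \<and> 0 < C \<and>
        (\<forall>f \<in> elems X. ennreal c * qnorm Y f \<le> qnorm X f \<and> qnorm X f \<le> ennreal C * qnorm Y f))"

text \<open>Powers with a positive real exponent; only \<open>a > 0\<close> is meaningful.\<close>

definition epowr :: "ennreal \<Rightarrow> real \<Rightarrow> ennreal" where
  "epowr x a = (if x = \<infinity> then \<infinity> else ennreal (enn2real x powr a))"

text \<open>
  The infimum is taken in \<^typ>\<open>ennreal\<close>, so that it is \<open>\<infinity>\<close> (rather than an unspecified real)
  if there is no admissible level. On a finite measure space this cannot happen for \<open>s > 0\<close>.
\<close>

definition decr_rearr :: "'a measure \<Rightarrow> ('a \<Rightarrow> real) \<Rightarrow> real \<Rightarrow> ennreal" where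
  "decr_rearr M f s =
     (INF t \<in> {t. 0 \<le> t \<and> emeasure M {x \<in> space M. \<bar>f x\<bar> > t} \<le> ennreal s}. ennreal t)"

definition Lebesgue_space :: "'a measure \<Rightarrow> real \<Rightarrow> 'a quasinormed_space" where
  "Lebesgue_space M p = space_of_qnorm M
     (\<lambda>f. epowr (\<integral>\<^sup>+ x. ennreal (\<bar>f x\<bar> powr p) \<partial>M) (1 / p))"

definition grand_Lebesgue_space :: "'a measure \<Rightarrow> real \<Rightarrow> 'a quasinormed_space" where
  "grand_Lebesgue_space M p = space_of_qnorm M
     (\<lambda>f. SUP t \<in> {0<..<1}. ennreal ((1 - ln t) powr (- 1 / p)) *
        epowr (\<integral>\<^sup>+ \<sigma> \<in> {t<..<1}. epowr (decr_rearr M f \<sigma>) p \<partial>lborel) (1 / p))"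

definition GGamma_space ::
    "'a measure \<Rightarrow> real \<Rightarrow> real \<Rightarrow> (real \<Rightarrow> real) \<Rightarrow> (real \<Rightarrow> real) \<Rightarrow> 'a quasinormed_space" where
  "GGamma_space M p m w1 w2 = space_of_qnorm M
     (\<lambda>f. epowr (\<integral>\<^sup>+ t \<in> {0<..<1}. ennreal (w1 t) *
        epowr (\<integral>\<^sup>+ \<sigma> \<in> {0<..<t}. epowr (decr_rearr M f \<sigma>) p * ennreal (w2 \<sigma>) \<partial>lborel) (m / p)
        \<partial>lborel) (1 / m))"

definition decompositions ::
    "'a measure \<Rightarrow> 'a quasinormed_space \<Rightarrow> 'a quasinormed_space \<Rightarrow>
      ('a \<Rightarrow> real) \<Rightarrow> (('a \<Rightarrow> real) \<times> ('a \<Rightarrow> real)) set" where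
  "decompositions M X0 X1 f =
     {(f0, f1). f0 \<in> elems X0 \<and> f1 \<in> elems X1 \<and> (AE x in M. f x = f0 x + f1 x)}"

definition sum_space ::
    "'a measure \<Rightarrow> 'a quasinormed_space \<Rightarrow> 'a quasinormed_space \<Rightarrow> ('a \<Rightarrow> real) set" where
  "sum_space M X0 X1 = {f \<in> borel_measurable M. decompositions M X0 X1 f \<noteq> {}}"

definition K_functional ::
    "'a measure \<Rightarrow> 'a quasinormed_space \<Rightarrow> 'a quasinormed_space \<Rightarrow>
      ('a \<Rightarrow> real) \<Rightarrow> real \<Rightarrow> ennreal" where
  "K_functional M X0 X1 f t =
     (INF (f0, f1) \<in> decompositions M X0 X1 f. qnorm X0 f0 + ennreal t * qnorm X1 f1)"

text \<open>
  The integral is over \<open>(0, 1)\<close> instead of \<open>(0, \<infinity>)\<close>, which is the usual convention for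
  ordered couples, that is, if \<open>X1\<close> is embedded in \<open>X0\<close>.
\<close>

definition interp_qnorm ::
    "'a measure \<Rightarrow> 'a quasinormed_space \<Rightarrow> 'a quasinormed_space \<Rightarrow> real \<Rightarrow> real \<Rightarrow>
      ('a \<Rightarrow> real) \<Rightarrow> ennreal" where
  "interp_qnorm M X0 X1 \<theta> r f =
     epowr (\<integral>\<^sup>+ t \<in> {0<..<1}.
        epowr (ennreal (t powr (- \<theta>)) * K_functional M X0 X1 f t) r * ennreal (1 / t) \<partial>lborel)
       (1 / r)"

definition interp_space ::
    "'a measure \<Rightarrow> 'a quasinormed_space \<Rightarrow> 'a quasinormed_space \<Rightarrow> real \<Rightarrow> real \<Rightarrow>
      'a quasinormed_space" where
  "interp_space M X0 X1 \<theta> r =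
     \<lparr>elems = {f \<in> sum_space M X0 X1. interp_qnorm M X0 X1 \<theta> r f < \<infinity>},
      qnorm = interp_qnorm M X0 X1 \<theta> r\<rparr>"

end

theory Submission
  imports Defs
begin

text \<open>
  Let \<open>g\<close> be the \<open>p\<close>-th power of the decreasing rearrangement of \<open>f\<close>, and for \<open>0 < t < 1\<close> let \<open>h\<close> be the
  point with \<open>1 - ln h = t powr (- p)\<close>. The natural candidate for an almost optimal decomposition of
  \<open>f\<close> at the parameter \<open>t\<close> is truncation at the height that the rearrangement has at \<open>h\<close>. It shows
  (\<open>K_functional_le_head_tail\<close>) that the \<open>p\<close>-th power of the K-functional is bounded, up to a
  constant, by the sum of the head \<open>A t\<close>, the integral of \<open>g \<sigma> / (1 - ln \<sigma>)\<close> over \<open>(0, h)\<close>, and the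
  tail, \<open>t powr p\<close> times the integral of \<open>g\<close> over \<open>(h, 1)\<close>. The head is the inner integral of the Gamma
  quasinorm; the substitution \<open>v = h\<close> turns the outer integral into the integral of \<open>A t\<close> to the power
  \<open>r / p\<close> against the weight of the interpolation quasinorm (\<open>GGamma_integral_eq\<close>).

  Neither direction of the comparison of \<open>A\<close> with the K-functional holds pointwise; both hold after
  summation over a geometric progression of parameters. For the ratio \<open>m = 2 powr (1 / p)\<close> the
  cuts \<open>h\<close> of the parameters \<open>m ^ k * t\<close> divide the unit interval into blocks on which \<open>1 - ln \<sigma>\<close>
  varies by the factor \<open>2\<close> only.
  \<^item> The interval \<open>(h, 1)\<close> is the union of the blocks at larger parameters, and the integral over
    each of them is bounded by a head (\<open>tail_integral_le_head_integrals\<close>). The \<open>p\<close>-th power of the K-functional at \<open>t\<close>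
    is therefore bounded by the sum of \<open>2 powr (- k) * A (m ^ k * t)\<close>. The monotonicity of \<open>g\<close>
    enters here, for the block that ends at \<open>1\<close>.
  \<^item> The interval \<open>(0, h)\<close> is the union of the blocks at smaller parameters, and the integral of \<open>g\<close>
    over a single block is bounded by the K-functional (\<open>block_le_K_functional\<close>), because on a block the defining
    supremum of the grand Lebesgue norm can be tested at one point.

  Both sums are absorbed by a Hardy inequality for sums over dilations (\<open>Hardy_dilation_sum\<close>). Its
  smallness condition is \<open>\<theta> < 1\<close> in the first case and \<open>\<theta> > 0\<close> in the second.
\<close>

section \<open>Powers of extended nonnegative reals\<close>

lemma epowr_ennreal: "0 \<le> x \<Longrightarrow> epowr (ennreal x) a = ennreal (x powr a)"
  by (simp add: epowr_def)

lemma epowr_top [simp]: "epowr top a = top"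
  by (simp add: epowr_def)

lemma epowr_0 [simp]: "epowr 0 a = 0"
  by (simp add: epowr_def)

lemma epowr_1 [simp]: "epowr x 1 = x"
  by (cases x) (auto simp: epowr_ennreal)

lemma epowr_eq_top_iff [simp]: "epowr x a = top \<longleftrightarrow> x = top"
  by (simp add: epowr_def)

lemma epowr_mono: "0 \<le> a \<Longrightarrow> x \<le> y \<Longrightarrow> epowr x a \<le> epowr y a"
  by (cases x; cases y) (auto simp: epowr_ennreal powr_mono2 top_unique)

lemma epowr_epowr: "epowr (epowr x a) b = epowr x (a * b)"
  by (cases x) (auto simp: epowr_ennreal powr_powr)

lemma epowr_mult: "epowr (x * y) a = epowr x a * epowr y a"
  by (cases x; cases y)
     (auto simp: epowr_ennreal powr_mult ennreal_mult_top ennreal_top_mult ennreal_mult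
           simp flip: ennreal_mult)

text \<open>
  The constant is the crude one from \<open>x + y \<le> 2 max x y\<close>; it serves all exponents at once,
  whether or not the power is convex.
\<close>

lemma epowr_add_le:
  assumes "0 \<le> a"
  shows "epowr (x + y) a \<le> ennreal (2 powr a) * (epowr x a + epowr y a)"
proof -
  have "x + y \<le> ennreal 2 * max x y"
    by (cases "x \<le> y") (auto simp: max_def mult_2 intro: add_mono)
  then have "epowr (x + y) a \<le> epowr (ennreal 2 * max x y) a"
    by (rule epowr_mono[OF assms])
  also have "\<dots> = ennreal (2 powr a) * epowr (max x y) a"
    unfolding epowr_mult by (subst epowr_ennreal) auto
  also have "\<dots> \<le> ennreal (2 powr a) * (epowr x a + epowr y a)"
    by (intro mult_left_mono) (auto simp: max_def)
  finally show ?thesis .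
qed

lemma epowr_le_iff:
  assumes "0 < a"
  shows "epowr x a \<le> y \<longleftrightarrow> x \<le> epowr y (1 / a)"
proof
  assume "epowr x a \<le> y"
  then have "epowr (epowr x a) (1 / a) \<le> epowr y (1 / a)"
    using assms by (intro epowr_mono) auto
  then show "x \<le> epowr y (1 / a)"
    using assms by (simp add: epowr_epowr)
next
  assume "x \<le> epowr y (1 / a)"
  then have "epowr x a \<le> epowr (epowr y (1 / a)) a"
    using assms by (intro epowr_mono) auto
  then show "epowr x a \<le> y"
    using assms by (simp add: epowr_epowr)
qed

lemma measurable_epowr [measurable (raw)]:
  assumes [measurable]: "f \<in> borel_measurable M"
  shows "(\<lambda>x. epowr (f x) a) \<in> borel_measurable M"
  unfolding epowr_def by measurable

section \<open>Measurability of monotone functions\<close>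

lemma borel_measurable_mono_ennreal:
  fixes f :: "real \<Rightarrow> ennreal"
  assumes "mono f"
  shows "f \<in> borel_measurable borel"
proof (rule borel_measurableI_greater)
  fix a
  have "is_interval (f -` {a<..})"
    unfolding is_interval_1 using monoD[OF assms] by (auto intro: less_le_trans)
  then show "{x \<in> space borel. a < f x} \<in> sets borel"
    by (auto dest!: real_interval_borel_measurable simp: vimage_def)
qed

lemma borel_measurable_antimono_ennreal:
  fixes f :: "real \<Rightarrow> ennreal"
  assumes "antimono f"
  shows "f \<in> borel_measurable borel"
proof -
  have "mono (\<lambda>x. f (- x))"
    using assms by (auto simp: monotone_def)
  from measurable_compose[OF borel_measurable_uminus[OF measurable_ident] borel_measurable_mono_ennreal[OF this]]
  show ?thesis by simp
qed

section \<open>Geometric progressions and series\<close>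

lemma real_between_powers:
  fixes m y :: real
  assumes "1 < m" "1 \<le> y"
  obtains k :: nat where "m ^ k \<le> y" "y < m ^ Suc k"
proof -
  define n where "n = (LEAST n. y < m ^ n)"
  have ex: "y < m ^ n"
    unfolding n_def using real_arch_pow[OF assms(1), of y] by (rule LeastI_ex)
  moreover have "n \<noteq> 0"
    using ex assms by (intro notI) simp
  moreover have "\<not> y < m ^ (n - 1)"
    using \<open>n \<noteq> 0\<close> unfolding n_def by (intro not_less_Least) auto
  ultimately show ?thesis
    by (intro that[of "n - 1"]) auto
qed

lemma suminf_ge_term:
  fixes f :: "nat \<Rightarrow> ennreal"
  shows "f k \<le> (\<Sum>i. f i)"
  using sum_le_suminf[of f "{k}"] by simp

lemma suminf_Suc_le:
  fixes f :: "nat \<Rightarrow> ennreal"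
  shows "(\<Sum>k. f (Suc k)) \<le> (\<Sum>k. f k)"
  unfolding suminf_eq_SUP[of "\<lambda>k. f (Suc k)"]
proof (rule SUP_least)
  fix n
  have "(\<Sum>i<n. f (Suc i)) \<le> (\<Sum>i<Suc n. f i)"
    by (simp add: sum.lessThan_Suc_shift del: sum.lessThan_Suc)
  also have "\<dots> \<le> (\<Sum>k. f k)"
    by (intro sum_le_suminf) auto
  finally show "(\<Sum>i<n. f (Suc i)) \<le> (\<Sum>k. f k)" .
qed

section \<open>A Hardy inequality for sums over dilations\<close>

text \<open>
  The quasinorm of \<open>L\<^sup>q\<close> on the half line with respect to the weight \<open>t\<close> to the power \<open>- a - 1\<close>,
  raised to the power \<open>q\<close>. Both quasinorms of the theorem become such integrals, with
  \<open>a = r \<theta>\<close> and \<open>q = r / p\<close>; the weight is homogeneous, which makes the effect of a dilation of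
  \<open>G\<close> a mere factor.
\<close>

definition scale_integral :: "real \<Rightarrow> real \<Rightarrow> (real \<Rightarrow> ennreal) \<Rightarrow> ennreal" where
  "scale_integral a q G = (\<integral>\<^sup>+ t \<in> {0<..}. ennreal (t powr (- a - 1)) * epowr (G t) q \<partial>lborel)"

text \<open>
  Only parameters in \<open>(0, 1)\<close> matter. Extension by zero makes dilated arguments harmless: terms of a
  sum over dilations that leave the interval vanish.
\<close>

definition on_unit :: "(real \<Rightarrow> ennreal) \<Rightarrow> real \<Rightarrow> ennreal" where
  "on_unit G t = (if 0 < t \<and> t < 1 then G t else 0)"

lemma scale_integral_cmult:
  assumes [measurable]: "G \<in> borel_measurable borel" and "0 \<le> c"
  shows "scale_integral a q (\<lambda>t. ennreal c * G t) = ennreal (c powr q) * scale_integral a q G"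
proof -
  have "scale_integral a q (\<lambda>t. ennreal c * G t)
    = (\<integral>\<^sup>+ t. ennreal (c powr q) * (ennreal (t powr (- a - 1)) * epowr (G t) q * indicator {0<..} t) \<partial>lborel)"
    unfolding scale_integral_def using assms(2)
    by (intro nn_integral_cong) (simp add: epowr_mult epowr_ennreal mult_ac)
  also have "\<dots> = ennreal (c powr q) * scale_integral a q G"
    unfolding scale_integral_def by (intro nn_integral_cmult) measurable
  finally show ?thesis .
qed

lemma nn_integral_dilation:
  fixes G :: "real \<Rightarrow> ennreal"
  assumes [measurable]: "G \<in> borel_measurable borel" and m: "0 < m"
  shows "(\<integral>\<^sup>+ t \<in> {0<..}. ennreal (t powr (- a - 1)) * G (m * t) \<partial>lborel)
       = ennreal (m powr a) * (\<integral>\<^sup>+ t \<in> {0<..}. ennreal (t powr (- a - 1)) * G t \<partial>lborel)"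
proof -
  have "(\<integral>\<^sup>+ t \<in> {0<..}. ennreal (t powr (- a - 1)) * G t \<partial>lborel)
     = ennreal \<bar>m\<bar> * (\<integral>\<^sup>+ t. ennreal ((0 + m * t) powr (- a - 1)) * G (0 + m * t)
          * indicator {0<..} (0 + m * t) \<partial>lborel)"
    using m by (intro nn_integral_real_affine) auto
  also have "(\<lambda>t. ennreal ((0 + m * t) powr (- a - 1)) * G (0 + m * t) * indicator {0<..} (0 + m * t))
     = (\<lambda>t. ennreal (m powr (- a - 1)) *
          (ennreal (t powr (- a - 1)) * G (m * t) * indicator {0<..} t))"
    using m by (auto simp: fun_eq_iff indicator_def zero_less_mult_iff powr_mult ennreal_mult mult.assoc)
  also have "(\<integral>\<^sup>+ t. ennreal (m powr (- a - 1)) *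
          (ennreal (t powr (- a - 1)) * G (m * t) * indicator {0<..} t) \<partial>lborel)
     = ennreal (m powr (- a - 1)) *
          (\<integral>\<^sup>+ t \<in> {0<..}. ennreal (t powr (- a - 1)) * G (m * t) \<partial>lborel)"
    by (intro nn_integral_cmult) measurable
  finally have "ennreal (m powr a) * (\<integral>\<^sup>+ t \<in> {0<..}. ennreal (t powr (- a - 1)) * G t \<partial>lborel)
     = (ennreal (m powr a) * (ennreal \<bar>m\<bar> * ennreal (m powr (- a - 1)))) *
          (\<integral>\<^sup>+ t \<in> {0<..}. ennreal (t powr (- a - 1)) * G (m * t) \<partial>lborel)"
    by (simp add: mult.assoc)
  also have "ennreal (m powr a) * (ennreal \<bar>m\<bar> * ennreal (m powr (- a - 1))) = 1"
  proof -
    have "m powr a * (m * m powr (- a - 1)) = 1"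
      using m by (simp add: powr_diff powr_minus field_simps)
    then show ?thesis
      using m by (simp flip: ennreal_mult)
  qed
  finally show ?thesis by simp
qed

text \<open>
  For \<open>q > 1\<close> this is usually derived from Hoelder's inequality, for \<open>q \<le> 1\<close> from subadditivity.
  The following argument treats all \<open>q > 0\<close> alike: every term of the series on the right is at
  most the whole sum \<open>S\<close>, so \<open>b k\<close> is at most \<open>S\<close> to the power \<open>1 / q\<close> times a term of a
  convergent geometric series. The price is the growing factor \<open>d ^ k\<close>.
\<close>

lemma epowr_suminf_le:
  fixes b :: "nat \<Rightarrow> ennreal" and q :: real
  assumes q: "0 < q" and d: "1 < d"
  shows "epowr (\<Sum>k. b k) q
    \<le> ennreal ((1 / (1 - d powr (- 1 / q))) powr q) * (\<Sum>k. ennreal (d ^ k) * epowr (b k) q)"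
proof -
  let ?S = "\<Sum>k. ennreal (d ^ k) * epowr (b k) q"
  let ?e = "d powr (- 1 / q)"
  have e: "0 < ?e" "?e < 1"
    using q d by (auto simp: powr_less_one)
  have term_le: "b k \<le> ennreal (?e ^ k) * epowr ?S (1 / q)" for k
  proof -
    have "ennreal (d ^ k) * epowr (b k) q = (\<Sum>i\<in>{k}. ennreal (d ^ i) * epowr (b i) q)"
      by simp
    also have "\<dots> \<le> ?S"
      by (intro sum_le_suminf) auto
    finally have "epowr (ennreal (d ^ k) * epowr (b k) q) (1 / q) \<le> epowr ?S (1 / q)"
      using q by (intro epowr_mono) auto
    then have "ennreal ((d ^ k) powr (1 / q)) * b k \<le> epowr ?S (1 / q)"
      using q d by (simp add: epowr_mult epowr_epowr epowr_ennreal)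
    then have "ennreal (?e ^ k) * (ennreal ((d ^ k) powr (1 / q)) * b k) \<le> ennreal (?e ^ k) * epowr ?S (1 / q)"
      by (intro mult_left_mono) auto
    also have "ennreal (?e ^ k) * (ennreal ((d ^ k) powr (1 / q)) * b k) = b k"
    proof -
      have "?e ^ k * (d ^ k) powr (1 / q) = 1"
        using d by (simp add: powr_power powr_realpow[symmetric] powr_powr flip: powr_add)
      then show ?thesis
        by (simp add: ennreal_mult[symmetric] mult.assoc[symmetric])
    qed
    finally show ?thesis .
  qed
  have "(\<Sum>k. b k) \<le> (\<Sum>k. ennreal (?e ^ k) * epowr ?S (1 / q))"
    by (intro suminf_le term_le) auto
  also have "\<dots> = ennreal (1 / (1 - ?e)) * epowr ?S (1 / q)"
  proof -
    have "(\<Sum>k. ennreal (?e ^ k)) = ennreal (1 / (1 - ?e))"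
      using e by (intro suminf_ennreal_eq geometric_sums) auto
    then show ?thesis by (simp only: ennreal_suminf_multc)
  qed
  finally have "epowr (\<Sum>k. b k) q \<le> epowr (ennreal (1 / (1 - ?e)) * epowr ?S (1 / q)) q"
    using q by (intro epowr_mono) auto
  also have "\<dots> = ennreal ((1 / (1 - ?e)) powr q) * ?S"
    using q e by (simp add: epowr_mult epowr_epowr epowr_ennreal)
  finally show ?thesis .
qed

text \<open>
  A dilation of the argument by \<open>m ^ k\<close> multiplies the integral by \<open>m powr (a k)\<close>, and the coefficient
  \<open>\<gamma> ^ k\<close> contributes \<open>\<gamma> powr (q k)\<close>. Hence the \<open>k\<close>-th term contributes the \<open>k\<close>-th power of
  \<open>\<rho> = \<gamma> powr q * m powr a < 1\<close>, and there is room for the factor \<open>d ^ k\<close> of the preceding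
  lemma with \<open>d\<close> the inverse square root of \<open>\<rho>\<close>. The constant does not depend on \<open>F\<close> and \<open>G\<close>.
\<close>

lemma Hardy_dilation_sum:
  fixes a m \<gamma> q :: real
  assumes q: "0 < q" and m: "0 < m" and \<gamma>: "0 < \<gamma>" and small: "\<gamma> powr q * m powr a < 1"
  obtains C where "0 < C"
    and "\<And>F G. G \<in> borel_measurable borel \<Longrightarrow>
      (\<And>t. 0 < t \<Longrightarrow> F t \<le> (\<Sum>k. ennreal (\<gamma> ^ k) * G (m ^ k * t))) \<Longrightarrow>
      scale_integral a q F \<le> ennreal C * scale_integral a q G"
proof -
  define \<rho> where "\<rho> = \<gamma> powr q * m powr a"
  have \<rho>: "0 < \<rho>" "\<rho> < 1"
    using assms by (auto simp: \<rho>_def)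
  \<comment> \<open>Any \<open>d\<close> with \<open>1 < d\<close> and \<open>d * \<rho> < 1\<close> works.\<close>
  define d where "d = 1 / sqrt \<rho>"
  have d: "1 < d" "d * \<rho> = sqrt \<rho>"
    using \<rho> by (auto simp: d_def real_div_sqrt)
  define W where "W = (1 / (1 - d powr (- 1 / q))) powr q"
  have W: "0 < W"
    using d q powr_less_one[of d "- 1 / q"] by (auto simp: W_def)
  define C where "C = W * (1 / (1 - sqrt \<rho>))"
  show ?thesis
  proof (rule that)
    show "0 < C"
      using W \<rho> by (auto simp: C_def)
    fix F G :: "real \<Rightarrow> ennreal"
    assume G [measurable]: "G \<in> borel_measurable borel"
      and FG: "\<And>t. 0 < t \<Longrightarrow> F t \<le> (\<Sum>k. ennreal (\<gamma> ^ k) * G (m ^ k * t))"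
    let ?w = "\<lambda>t. ennreal (t powr (- a - 1))"
    let ?I = "\<integral>\<^sup>+ t \<in> {0<..}. ?w t * epowr (G t) q \<partial>lborel"
    have pw: "epowr (F t) q \<le> ennreal W * (\<Sum>k. ennreal ((d * \<gamma> powr q) ^ k) * epowr (G (m ^ k * t)) q)"
      if "0 < t" for t
    proof -
      have "epowr (F t) q \<le> epowr (\<Sum>k. ennreal (\<gamma> ^ k) * G (m ^ k * t)) q"
        using q FG[OF that] by (intro epowr_mono) auto
      also have "\<dots> \<le> ennreal W * (\<Sum>k. ennreal (d ^ k) * epowr (ennreal (\<gamma> ^ k) * G (m ^ k * t)) q)"
        unfolding W_def by (rule epowr_suminf_le[OF q d(1)])
      also have "(\<lambda>k. ennreal (d ^ k) * epowr (ennreal (\<gamma> ^ k) * G (m ^ k * t)) q)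
          = (\<lambda>k. ennreal ((d * \<gamma> powr q) ^ k) * epowr (G (m ^ k * t)) q)"
      proof
        fix k
        have "(\<gamma> ^ k) powr q = (\<gamma> powr q) ^ k"
          using \<gamma> by (simp add: powr_realpow[symmetric] powr_powr mult.commute)
        then show "ennreal (d ^ k) * epowr (ennreal (\<gamma> ^ k) * G (m ^ k * t)) q
            = ennreal ((d * \<gamma> powr q) ^ k) * epowr (G (m ^ k * t)) q"
          using \<gamma> d by (simp add: epowr_mult epowr_ennreal ennreal_mult power_mult_distrib mult.assoc)
      qed
      finally show ?thesis .
    qed
    have "(\<integral>\<^sup>+ t \<in> {0<..}. ?w t * epowr (F t) q \<partial>lborel)
      \<le> (\<integral>\<^sup>+ t. ennreal W * (\<Sum>k. ennreal ((d * \<gamma> powr q) ^ k) *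
            (?w t * epowr (G (m ^ k * t)) q * indicator {0<..} t)) \<partial>lborel)"
    proof (intro nn_integral_mono)
      fix t :: real
      show "?w t * epowr (F t) q * indicator {0<..} t
        \<le> ennreal W * (\<Sum>k. ennreal ((d * \<gamma> powr q) ^ k) *
            (?w t * epowr (G (m ^ k * t)) q * indicator {0<..} t))"
      proof (cases "0 < t")
        case True
        then have "?w t * epowr (F t) q
          \<le> ?w t * (ennreal W * (\<Sum>k. ennreal ((d * \<gamma> powr q) ^ k) * epowr (G (m ^ k * t)) q))"
          by (intro mult_left_mono pw) auto
        also have "\<dots> = ennreal W * (?w t * (\<Sum>k. ennreal ((d * \<gamma> powr q) ^ k) * epowr (G (m ^ k * t)) q))"
          by (simp only: mult.left_commute)
        also have "?w t * (\<Sum>k. ennreal ((d * \<gamma> powr q) ^ k) * epowr (G (m ^ k * t)) q)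
          = (\<Sum>k. ennreal ((d * \<gamma> powr q) ^ k) * (?w t * epowr (G (m ^ k * t)) q))"
          by (subst ennreal_suminf_cmult[symmetric]) (simp only: mult.left_commute)
        finally show ?thesis
          using True by simp
      qed simp
    qed
    also have "\<dots> = ennreal W * (\<Sum>k. ennreal ((d * \<gamma> powr q) ^ k) *
            (\<integral>\<^sup>+ t \<in> {0<..}. ?w t * epowr (G (m ^ k * t)) q \<partial>lborel))"
      by (simp add: nn_integral_cmult nn_integral_suminf del: ennreal_suminf_cmult)
    also have "\<dots> = ennreal W * (\<Sum>k. ennreal (sqrt \<rho> ^ k) * ?I)"
    proof -
      have "ennreal ((d * \<gamma> powr q) ^ k) * (\<integral>\<^sup>+ t \<in> {0<..}. ?w t * epowr (G (m ^ k * t)) q \<partial>lborel)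
          = ennreal (sqrt \<rho> ^ k) * ?I" for k
      proof -
        have "(\<integral>\<^sup>+ t \<in> {0<..}. ?w t * epowr (G (m ^ k * t)) q \<partial>lborel) = ennreal ((m ^ k) powr a) * ?I"
          using m by (intro nn_integral_dilation[of "\<lambda>t. epowr (G t) q"]) auto
        moreover have "(d * \<gamma> powr q) ^ k * (m ^ k) powr a = sqrt \<rho> ^ k"
        proof -
          have "(m ^ k) powr a = (m powr a) ^ k"
            using m by (simp add: powr_realpow[symmetric] powr_powr mult.commute)
          then have "(d * \<gamma> powr q) ^ k * (m ^ k) powr a = (d * \<rho>) ^ k"
            by (simp add: power_mult_distrib \<rho>_def)
          then show ?thesis by (simp add: d)
        qed
        ultimately show ?thesis
          using d by (simp add: mult.assoc[symmetric] flip: ennreal_mult)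
      qed
      then show ?thesis by (simp del: ennreal_suminf_multc)
    qed
    also have "\<dots> = ennreal C * ?I"
    proof -
      have "(\<Sum>k. ennreal (sqrt \<rho> ^ k)) = ennreal (1 / (1 - sqrt \<rho>))"
        using \<rho> by (intro suminf_ennreal_eq geometric_sums) auto
      then have "(\<Sum>k. ennreal (sqrt \<rho> ^ k) * ?I) = ennreal (1 / (1 - sqrt \<rho>)) * ?I"
        by (simp only: ennreal_suminf_multc)
      then show ?thesis
        using \<rho> W by (simp only: C_def) (subst ennreal_mult, auto simp: mult.assoc)
    qed
    finally show "scale_integral a q F \<le> ennreal C * scale_integral a q G"
      unfolding scale_integral_def .
  qed
qed

section \<open>The decreasing rearrangement\<close>

lemma antimono_decr_rearr: "antimono (decr_rearr M f)"
proof (rule antimonoI)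
  fix s s' :: real
  assume "s \<le> s'"
  then show "decr_rearr M f s' \<le> decr_rearr M f s"
    unfolding decr_rearr_def by (intro INF_superset_mono) (auto intro: order_trans ennreal_leI)
qed

lemma decr_rearr_antimono: "s \<le> s' \<Longrightarrow> decr_rearr M f s' \<le> decr_rearr M f s"
  using antimono_decr_rearr by (rule antimonoD)

lemma measurable_decr_rearr [measurable]: "decr_rearr M f \<in> borel_measurable borel"
  by (rule borel_measurable_antimono_ennreal[OF antimono_decr_rearr])

text \<open>
  The distribution function is right continuous, so the infimum that defines the rearrangement is
  attained.
\<close>

lemma decr_rearr_le_iff:
  assumes [measurable]: "f \<in> borel_measurable M" and t: "0 \<le> t"
  shows "decr_rearr M f s \<le> ennreal t \<longleftrightarrow> emeasure M {x \<in> space M. \<bar>f x\<bar> > t} \<le> ennreal s"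
proof
  assume "emeasure M {x \<in> space M. \<bar>f x\<bar> > t} \<le> ennreal s"
  then show "decr_rearr M f s \<le> ennreal t"
    unfolding decr_rearr_def using t by (intro INF_lower2[of t]) auto
next
  assume le: "decr_rearr M f s \<le> ennreal t"
  let ?A = "\<lambda>n. {x \<in> space M. \<bar>f x\<bar> > t + 1 / Suc n}"
  have A: "emeasure M (?A n) \<le> ennreal s" for n
  proof -
    have "decr_rearr M f s < ennreal (t + 1 / Suc n)"
      using le by (rule order.strict_trans1) (use t in \<open>simp add: ennreal_less_iff\<close>)
    then obtain t' where t': "0 \<le> t'" "emeasure M {x \<in> space M. \<bar>f x\<bar> > t'} \<le> ennreal s"
      "ennreal t' < ennreal (t + 1 / Suc n)"
      unfolding decr_rearr_def INF_less_iff by auto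
    have "emeasure M (?A n) \<le> emeasure M {x \<in> space M. \<bar>f x\<bar> > t'}"
      using t' by (intro emeasure_mono) (auto simp: ennreal_less_iff)
    then show ?thesis using t' by simp
  qed
  have "{x \<in> space M. \<bar>f x\<bar> > t} = (\<Union>n. ?A n)"
  proof safe
    fix x assume x: "x \<in> space M" "t < \<bar>f x\<bar>"
    then obtain n where "inverse (real (Suc n)) < \<bar>f x\<bar> - t"
      using reals_Archimedean[of "\<bar>f x\<bar> - t"] by auto
    then show "x \<in> (\<Union>n. ?A n)"
      using x by (auto simp: inverse_eq_divide intro!: exI[of _ n])
  next
    fix x n assume "t + 1 / real (Suc n) < \<bar>f x\<bar>"
    moreover have "0 < 1 / real (Suc n)" by simp
    ultimately show "t < \<bar>f x\<bar>" by linarith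
  qed
  also have "emeasure M (\<Union>n. ?A n) = (SUP n. emeasure M (?A n))"
  proof (intro SUP_emeasure_incseq[symmetric] incseq_SucI subsetI)
    fix n x assume "x \<in> ?A n"
    moreover have "1 / real (Suc (Suc n)) \<le> 1 / real (Suc n)" by (simp add: frac_le)
    ultimately show "x \<in> ?A (Suc n)" by auto
  qed auto
  also have "\<dots> \<le> ennreal s" by (intro SUP_least A)
  finally show "emeasure M {x \<in> space M. \<bar>f x\<bar> > t} \<le> ennreal s" .
qed

lemma decr_rearr_finite:
  assumes [measurable]: "f \<in> borel_measurable M" and fin: "emeasure M (space M) < \<infinity>" and s: "0 < s"
  shows "decr_rearr M f s < \<infinity>"
proof -
  let ?A = "\<lambda>n. {x \<in> space M. \<bar>f x\<bar> > real n}"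
  have "(\<lambda>n. emeasure M (?A n)) \<longlonglongrightarrow> emeasure M (\<Inter>n. ?A n)"
  proof (intro Lim_emeasure_decseq)
    show "decseq ?A" by (auto simp: decseq_def)
    show "emeasure M (?A n) \<noteq> \<infinity>" for n
      using emeasure_space[of M "?A n"] fin by (auto simp: top_unique)
  qed auto
  moreover have "(\<Inter>n. ?A n) = {}"
  proof (rule equals0I)
    fix x assume x: "x \<in> (\<Inter>n. ?A n)"
    obtain n where "\<bar>f x\<bar> < real n" using reals_Archimedean2 by blast
    moreover have "x \<in> ?A n" using x by (rule INT_D) simp
    ultimately show False by simp
  qed
  ultimately have "(\<lambda>n. emeasure M (?A n)) \<longlonglongrightarrow> 0" by simp
  then have "\<forall>\<^sub>F n in sequentially. emeasure M (?A n) < ennreal s"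
    using s by (intro order_tendstoD) auto
  then obtain n where "emeasure M (?A n) < ennreal s"
    by (auto simp: eventually_sequentially)
  then have "decr_rearr M f s \<le> ennreal n"
    by (subst decr_rearr_le_iff) auto
  then show ?thesis by (simp add: le_less_trans)
qed

lemma decr_rearr_mono:
  assumes [measurable]: "g \<in> borel_measurable M" and "\<And>x. x \<in> space M \<Longrightarrow> \<bar>f x\<bar> \<le> \<bar>g x\<bar>"
  shows "decr_rearr M f s \<le> decr_rearr M g s"
  unfolding decr_rearr_def
proof (intro INF_superset_mono subsetI)
  fix t assume t: "t \<in> {t. 0 \<le> t \<and> emeasure M {x \<in> space M. t < \<bar>g x\<bar>} \<le> ennreal s}"
  have "emeasure M {x \<in> space M. t < \<bar>f x\<bar>} \<le> emeasure M {x \<in> space M. t < \<bar>g x\<bar>}"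
    using assms(2) by (intro emeasure_mono) (auto intro: less_le_trans)
  then show "t \<in> {t. 0 \<le> t \<and> emeasure M {x \<in> space M. t < \<bar>f x\<bar>} \<le> ennreal s}"
    using t by auto
qed auto

lemma decr_rearr_add_le:
  assumes [measurable]: "f \<in> borel_measurable M" "g \<in> borel_measurable M" "h \<in> borel_measurable M"
    and f: "AE x in M. f x = g x + h x" and s: "0 \<le> s" "0 \<le> t"
  shows "decr_rearr M f (s + t) \<le> decr_rearr M g s + decr_rearr M h t"
proof -
  have *: "decr_rearr M f (s + t) \<le> ennreal a + ennreal b"
    if a: "0 \<le> a" "emeasure M {x \<in> space M. \<bar>g x\<bar> > a} \<le> ennreal s"
    and b: "0 \<le> b" "emeasure M {x \<in> space M. \<bar>h x\<bar> > b} \<le> ennreal t" for a b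
  proof -
    have "emeasure M {x \<in> space M. \<bar>f x\<bar> > a + b}
      \<le> emeasure M ({x \<in> space M. \<bar>g x\<bar> > a} \<union> {x \<in> space M. \<bar>h x\<bar> > b})"
      using f by (intro emeasure_mono_AE) (auto elim!: eventually_mono)
    also have "\<dots> \<le> emeasure M {x \<in> space M. \<bar>g x\<bar> > a} + emeasure M {x \<in> space M. \<bar>h x\<bar> > b}"
      by (intro emeasure_subadditive) auto
    also have "\<dots> \<le> ennreal (s + t)"
      using a b s by (simp add: add_mono)
    finally have "decr_rearr M f (s + t) \<le> ennreal (a + b)"
      using a b by (subst decr_rearr_le_iff) auto
    then show ?thesis using a b by simp
  qed
  show ?thesis
  proof (cases "decr_rearr M g s = \<infinity> \<or> decr_rearr M h t = \<infinity>")
    case True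
    then show ?thesis by auto
  next
    case False
    then obtain a b where ab: "0 \<le> a" "decr_rearr M g s = ennreal a" "0 \<le> b" "decr_rearr M h t = ennreal b"
      by (cases "decr_rearr M g s"; cases "decr_rearr M h t") auto
    have "emeasure M {x \<in> space M. \<bar>g x\<bar> > a} \<le> ennreal s" "emeasure M {x \<in> space M. \<bar>h x\<bar> > b} \<le> ennreal t"
      using ab by (auto simp flip: decr_rearr_le_iff)
    then show ?thesis
      unfolding ab using ab by (intro *) auto
  qed
qed

lemma decr_rearr_le_bound:
  assumes "\<And>x. x \<in> space M \<Longrightarrow> \<bar>f x\<bar> \<le> c" and "0 \<le> c"
  shows "decr_rearr M f s \<le> ennreal c"
proof -
  have "{x \<in> space M. c < \<bar>f x\<bar>} = {}"
    using assms by force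
  then have "emeasure M {x \<in> space M. c < \<bar>f x\<bar>} = 0"
    by (simp only: emeasure_empty)
  then show ?thesis
    unfolding decr_rearr_def using assms by (intro INF_lower2[of c]) auto
qed

text \<open>
  The rearrangement, as a function on the unit interval with Lebesgue measure, has the same
  distribution as \<open>\<bar>f\<bar>\<close>: by \<open>decr_rearr_le_iff\<close> the set where it exceeds \<open>t \<ge> 0\<close> is the
  interval from \<open>0\<close> to the measure of the set where \<open>\<bar>f\<bar>\<close> exceeds \<open>t\<close>.
\<close>

lemma nn_integral_decr_rearr:
  assumes [measurable]: "f \<in> borel_measurable M" and one: "emeasure M (space M) = 1"
  shows "(\<integral>\<^sup>+ \<sigma> \<in> {0<..<1}. epowr (decr_rearr M f \<sigma>) p \<partial>lborel)
    = (\<integral>\<^sup>+ x. ennreal (\<bar>f x\<bar> powr p) \<partial>M)"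
proof -
  interpret finite_measure M
    by standard (simp add: one)
  define R where "R = (\<lambda>s. enn2real (decr_rearr M f s))"
  have [measurable]: "R \<in> borel_measurable borel"
    unfolding R_def by measurable
  have R_nonneg: "0 \<le> R s" for s
    by (simp add: R_def)
  have R: "decr_rearr M f s = ennreal (R s)" if "0 < s" for s
    using decr_rearr_finite[of f M s] one that by (simp add: R_def less_top)
  let ?U = "restrict_space lborel {0<..<1::real}"
  have "distr ?U borel R = distr M borel (\<lambda>x. \<bar>f x\<bar>)"
  proof (rule measure_eqI_lessThan)
    fix t
    have eU: "emeasure (distr ?U borel R) {t<..} = emeasure lborel {s \<in> {0<..<1}. t < R s}"
    proof -
      have "R \<in> measurable ?U borel"
        by (rule measurable_restrict_space1) simp
      then have "emeasure (distr ?U borel R) {t<..} = emeasure ?U (R -` {t<..} \<inter> space ?U)"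
        by (intro emeasure_distr) auto
      also have "R -` {t<..} \<inter> space ?U = {s \<in> {0<..<1}. t < R s}"
        by (auto simp: space_restrict_space)
      also have "emeasure ?U \<dots> = emeasure lborel {s \<in> {0<..<1}. t < R s}"
        by (intro emeasure_restrict_space) auto
      finally show ?thesis .
    qed
    have eM: "emeasure (distr M borel (\<lambda>x. \<bar>f x\<bar>)) {t<..} = emeasure M {x \<in> space M. t < \<bar>f x\<bar>}"
      by (subst emeasure_distr) (auto intro!: arg_cong2[where f=emeasure])
    have "emeasure lborel {s \<in> {0<..<1}. t < R s} \<le> emeasure lborel {0<..<1::real}"
      by (intro emeasure_mono) auto
    then show "emeasure (distr ?U borel R) {t<..} < \<infinity>"
      unfolding eU by (simp add: le_less_trans)
    show "emeasure (distr ?U borel R) {t<..} = emeasure (distr M borel (\<lambda>x. \<bar>f x\<bar>)) {t<..}"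
    proof (cases "0 \<le> t")
      case False
      then have "{s \<in> {0<..<1}. t < R s} = {0<..<1}" "{x \<in> space M. t < \<bar>f x\<bar>} = space M"
        by (auto simp: R_def intro: less_le_trans[of t 0])
      then show ?thesis unfolding eU eM by (simp add: one)
    next
      case True
      let ?m = "measure M {x \<in> space M. t < \<bar>f x\<bar>}"
      have m1: "?m \<le> 1"
        using bounded_measure[of "{x \<in> space M. t < \<bar>f x\<bar>}"] one by (simp add: measure_def)
      have "t < R s \<longleftrightarrow> s < ?m" if "0 < s" for s
      proof -
        have "R s \<le> t \<longleftrightarrow> decr_rearr M f s \<le> ennreal t"
          using R[OF that] True by simp
        also have "\<dots> \<longleftrightarrow> ?m \<le> s"
          using that True by (simp add: decr_rearr_le_iff emeasure_eq_measure)
        finally show ?thesis by auto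
      qed
      then have "{s \<in> {0<..<1}. t < R s} = {0<..<?m}"
        using m1 by auto
      then show ?thesis
        unfolding eU eM by (simp add: emeasure_eq_measure)
    qed
  qed auto
  then have "(\<integral>\<^sup>+ y. ennreal (y powr p) \<partial>distr ?U borel R)
    = (\<integral>\<^sup>+ y. ennreal (y powr p) \<partial>distr M borel (\<lambda>x. \<bar>f x\<bar>))" by simp
  moreover have "(\<integral>\<^sup>+ y. ennreal (y powr p) \<partial>distr M borel (\<lambda>x. \<bar>f x\<bar>))
    = (\<integral>\<^sup>+ x. ennreal (\<bar>f x\<bar> powr p) \<partial>M)"
    by (subst nn_integral_distr) auto
  moreover have "(\<integral>\<^sup>+ y. ennreal (y powr p) \<partial>distr ?U borel R)
    = (\<integral>\<^sup>+ \<sigma> \<in> {0<..<1}. epowr (decr_rearr M f \<sigma>) p \<partial>lborel)"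
  proof -
    have "(\<integral>\<^sup>+ y. ennreal (y powr p) \<partial>distr ?U borel R) = (\<integral>\<^sup>+ s. ennreal (R s powr p) \<partial>?U)"
      by (intro nn_integral_distr measurable_restrict_space1) auto
    also have "\<dots> = (\<integral>\<^sup>+ s \<in> {0<..<1}. ennreal (R s powr p) \<partial>lborel)"
      by (intro nn_integral_restrict_space) auto
    also have "\<dots> = (\<integral>\<^sup>+ \<sigma> \<in> {0<..<1}. epowr (decr_rearr M f \<sigma>) p \<partial>lborel)"
      by (intro nn_integral_cong) (auto simp: indicator_def R epowr_ennreal R_nonneg)
    finally show ?thesis .
  qed
  ultimately show ?thesis by simp
qed

section \<open>The logarithmic scale\<close>

text \<open>
  The point of the unit interval at which \<open>1 - ln \<sigma>\<close> equals \<open>t powr (- p)\<close>. At the parameter \<open>t\<close> of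
  the K-functional, a function is truncated at the value of its rearrangement at this point.
\<close>

definition log_cut :: "real \<Rightarrow> real \<Rightarrow> real" where
  "log_cut p t = exp (1 - t powr (- p))"

text \<open>
  The inner integral of the Gamma quasinorm, as a function of the parameter of the K-functional.
\<close>

definition head_integral :: "real \<Rightarrow> (real \<Rightarrow> ennreal) \<Rightarrow> real \<Rightarrow> ennreal" where
  "head_integral p g t =
     (\<integral>\<^sup>+ \<sigma> \<in> {0<..<log_cut p t}. g \<sigma> * ennreal ((1 - ln \<sigma>) powr (- 1)) \<partial>lborel)"

lemma log_cut_pos [simp]: "0 < log_cut p t"
  by (simp add: log_cut_def)

lemma log_cut_nonneg [simp]: "0 \<le> log_cut p t"
  by (simp add: log_cut_def)

lemma log_cut_neq_0 [simp]: "log_cut p t \<noteq> 0"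
  by (simp add: log_cut_def)

lemma one_minus_ln_log_cut: "1 - ln (log_cut p t) = t powr (- p)"
  by (simp add: log_cut_def)

lemma log_cut_less_iff:
  assumes "0 < p" "0 < s" "0 < t"
  shows "log_cut p s < log_cut p t \<longleftrightarrow> s < t"
proof -
  have "s powr p < t powr p \<longleftrightarrow> s < t"
    using assms by (metis linorder_less_linear order_less_asym powr_less_mono2 less_imp_le)
  then show ?thesis
    using assms by (simp add: log_cut_def powr_minus field_simps)
qed

lemma log_cut_le_iff:
  assumes "0 < p" "0 < s" "0 < t"
  shows "log_cut p s \<le> log_cut p t \<longleftrightarrow> s \<le> t"
  using log_cut_less_iff[OF assms(1,3,2)] by auto

lemma log_cut_1 [simp]: "log_cut p 1 = 1"
  by (simp add: log_cut_def)

lemma log_cut_less_1_iff: "0 < p \<Longrightarrow> 0 < t \<Longrightarrow> log_cut p t < 1 \<longleftrightarrow> t < 1"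
  using log_cut_less_iff[of p t 1] by simp

lemma one_minus_ln_pos: "0 < \<sigma> \<Longrightarrow> \<sigma> \<le> 1 \<Longrightarrow> 1 \<le> 1 - ln (\<sigma>::real)"
  by simp

lemma obtain_log_cut_eq:
  assumes "0 < p" "0 < \<sigma>" "\<sigma> < 1"
  obtains u where "0 < u" "u < 1" "\<sigma> = log_cut p u"
proof
  let ?u = "(1 - ln \<sigma>) powr (- 1 / p)"
  have L: "1 < 1 - ln \<sigma>" using assms by simp
  show "0 < ?u" using L by simp
  have "\<bar>1 - ln \<sigma>\<bar> = 1 - ln \<sigma>" using L by linarith
  then have "?u powr (- p) = 1 - ln \<sigma>" using assms by (simp add: powr_powr)
  then show *: "\<sigma> = log_cut p ?u" using assms by (simp add: log_cut_def)
  show "?u < 1"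
    using assms L by (intro powr_less_one) auto
qed

lemma weight_between_cuts:
  assumes p: "0 < p" and u: "0 < u" "u \<le> 1" and \<sigma>: "0 < \<sigma>"
  shows "\<sigma> \<le> log_cut p u \<Longrightarrow> (1 - ln \<sigma>) powr (- 1) \<le> u powr p"
    and "log_cut p u \<le> \<sigma> \<Longrightarrow> \<sigma> \<le> 1 \<Longrightarrow> u powr p \<le> (1 - ln \<sigma>) powr (- 1)"
proof -
  have upos: "0 < u powr (- p)" using u by simp
  have eq: "u powr p = (1 - ln (log_cut p u)) powr (- 1)"
    unfolding one_minus_ln_log_cut powr_powr by simp
  have c: "log_cut p u \<le> 1" using log_cut_le_iff[of p u 1] p u by simp
  { assume "\<sigma> \<le> log_cut p u"
    then have "ln \<sigma> \<le> ln (log_cut p u)" using \<sigma> by simp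
    then have "1 - ln (log_cut p u) \<le> 1 - ln \<sigma>" by simp
    then show "(1 - ln \<sigma>) powr (- 1) \<le> u powr p"
      unfolding eq using upos by (intro powr_mono2') (auto simp: one_minus_ln_log_cut) }
  { assume "log_cut p u \<le> \<sigma>" "\<sigma> \<le> 1"
    then have "ln (log_cut p u) \<le> ln \<sigma>" using \<sigma> by simp
    moreover have "ln \<sigma> \<le> 0" using \<sigma> \<open>\<sigma> \<le> 1\<close> by simp
    ultimately show "u powr p \<le> (1 - ln \<sigma>) powr (- 1)"
      unfolding eq by (intro powr_mono2') auto }
qed

section \<open>Head and tail of a function, cut into blocks\<close>

text \<open>
  The weight \<open>1 / (1 - ln \<sigma>)\<close> increases, so on a block it is at most its value at the right end, which
  is the \<open>p\<close>-th power of the corresponding parameter.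
\<close>

lemma head_integral_le_block_sum:
  assumes p: "0 < p" and m: "1 < m" and t: "0 < t" "t \<le> 1"
    and [measurable]: "g \<in> borel_measurable borel"
  shows "head_integral p g t \<le> (\<Sum>k. ennreal (((1 / m) ^ k * t) powr p) *
     (\<integral>\<^sup>+ \<sigma> \<in> {log_cut p ((1 / m) ^ k * t / m)<..log_cut p ((1 / m) ^ k * t)}. g \<sigma> \<partial>lborel))"
proof -
  let ?l = "\<lambda>k. (1 / m) ^ k * t"
  let ?B = "\<lambda>k. {log_cut p (?l k / m)<..log_cut p (?l k)}"
  have l: "0 < ?l k" "?l k \<le> 1" for k
  proof -
    have "(1 / m) ^ k \<le> 1" using m by (intro power_le_one) auto
    then show "?l k \<le> 1" using t by (simp add: mult_le_one)
    show "0 < ?l k" using m t by simp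
  qed
  have "head_integral p g t \<le> (\<integral>\<^sup>+ \<sigma>. (\<Sum>k. ennreal (?l k powr p) * (g \<sigma> * indicator (?B k) \<sigma>)) \<partial>lborel)"
    unfolding head_integral_def
  proof (intro nn_integral_mono)
    fix \<sigma> :: real
    show "g \<sigma> * ennreal ((1 - ln \<sigma>) powr - 1) * indicator {0<..<log_cut p t} \<sigma>
         \<le> (\<Sum>k. ennreal (?l k powr p) * (g \<sigma> * indicator (?B k) \<sigma>))"
    proof (cases "0 < \<sigma> \<and> \<sigma> < log_cut p t")
      case True
      have "log_cut p t \<le> 1"
        using log_cut_le_iff[of p t 1] p t by simp
      then obtain u where u: "0 < u" "\<sigma> = log_cut p u"
        using obtain_log_cut_eq[of p \<sigma>] True p by (metis order_less_le_trans)
      then have "u < t"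
        using True p t by (simp add: log_cut_less_iff)
      then obtain k where k: "m ^ k \<le> t / u" "t / u < m ^ Suc k"
        using real_between_powers[OF m, of "t / u"] u by auto
      then have "u \<le> ?l k" "?l k / m < u"
        using u m by (auto simp: field_simps power_one_over)
      then have "\<sigma> \<in> ?B k"
        using u l p m by (auto simp: log_cut_less_iff log_cut_le_iff)
      moreover from this have "(1 - ln \<sigma>) powr - 1 \<le> ?l k powr p"
        using weight_between_cuts(1)[OF p l(1)[of k] l(2)[of k], of \<sigma>] True by auto
      ultimately have "g \<sigma> * ennreal ((1 - ln \<sigma>) powr - 1) * indicator {0<..<log_cut p t} \<sigma>
        \<le> ennreal (?l k powr p) * (g \<sigma> * indicator (?B k) \<sigma>)"
        using True by (simp add: mult.commute mult_left_mono ennreal_leI)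
      also have "\<dots> \<le> (\<Sum>k. ennreal (?l k powr p) * (g \<sigma> * indicator (?B k) \<sigma>))"
        by (rule suminf_ge_term)
      finally show ?thesis .
    qed auto
  qed
  also have "\<dots> = (\<Sum>k. ennreal (?l k powr p) * (\<integral>\<^sup>+ \<sigma> \<in> ?B k. g \<sigma> \<partial>lborel))"
    by (simp add: nn_integral_suminf nn_integral_cmult)
  finally show ?thesis .
qed

text \<open>
  Only the right half of the interval \<open>(0, log_cut p t)\<close> is used: there \<open>g\<close> is at least its value at the
  right end, and the weight has lost at most the factor \<open>2\<close>, because halving the argument increases
  \<open>1 - ln \<sigma>\<close> by \<open>ln 2 \<le> 1 \<le> 1 - ln \<sigma>\<close>.
\<close>

lemma value_at_cut_le_head_integral:
  assumes p: "0 < p" and t: "0 < t" "t \<le> 1" and g: "antimono g"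
  shows "ennreal (log_cut p t * t powr p) * g (log_cut p t) \<le> ennreal 4 * head_integral p g t"
proof -
  let ?c = "log_cut p t"
  have tp: "1 \<le> t powr (- p)"
    using t p by (simp add: ge_one_powr_ge_zero powr_minus one_le_inverse_iff powr_le1)
  have w: "t powr p / 2 \<le> (1 - ln \<sigma>) powr (- 1)" if \<sigma>: "?c / 2 < \<sigma>" "\<sigma> < ?c" for \<sigma>
  proof -
    have \<sigma>0: "0 < \<sigma>" using \<sigma>(1) log_cut_pos[of p t] by linarith
    have "ln (?c / 2) \<le> ln \<sigma>" using \<sigma> log_cut_pos[of p t] \<sigma>0 by (subst ln_le_cancel_iff) auto
    moreover have "ln (?c / 2) = ln ?c - ln 2" by (simp add: ln_div)
    moreover have "ln 2 \<le> (1::real)" using ln_le_minus_one[of "2::real"] by simp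
    ultimately have "1 - ln \<sigma> \<le> 2 * t powr (- p)"
      using one_minus_ln_log_cut[of p t] tp by linarith
    moreover have "?c \<le> 1" using log_cut_le_iff[of p t 1] p t by simp
    then have "\<sigma> \<le> 1" using \<sigma> by linarith
    then have "0 < 1 - ln \<sigma>" using ln_le_zero_iff[OF \<sigma>0] by linarith
    ultimately have "(2 * t powr (- p)) powr (- 1) \<le> (1 - ln \<sigma>) powr (- 1)"
      by (intro powr_mono2') auto
    also have "(2 * t powr (- p)) powr (- 1) = t powr p / 2"
      using t by (simp add: powr_mult powr_powr powr_minus)
    finally show ?thesis .
  qed
  have "ennreal (?c * t powr p / 4) * g ?c = (\<integral>\<^sup>+ \<sigma> \<in> {?c / 2<..<?c}. g ?c * ennreal (t powr p / 2) \<partial>lborel)"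
  proof -
    have "ennreal (?c * t powr p / 4) = ennreal (t powr p / 2) * ennreal (?c / 2)"
      by (subst ennreal_mult[symmetric]) (auto simp: less_imp_le mult_ac)
    then show ?thesis
      using log_cut_pos[of p t] by (subst nn_integral_cmult_indicator) (simp_all add: mult_ac)
  qed
  also have "\<dots> \<le> head_integral p g t"
    unfolding head_integral_def
  proof (intro nn_integral_mono)
    fix \<sigma>
    show "g ?c * ennreal (t powr p / 2) * indicator {?c / 2<..<?c} \<sigma>
      \<le> g \<sigma> * ennreal ((1 - ln \<sigma>) powr - 1) * indicator {0<..<?c} \<sigma>"
    proof (cases "?c / 2 < \<sigma> \<and> \<sigma> < ?c")
      case True
      then have "0 < \<sigma>" using log_cut_pos[of p t] by linarith
      with True show ?thesis
        using w[of \<sigma>] antimonoD[OF g, of \<sigma> ?c] by (auto intro!: mult_mono ennreal_leI)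
    qed auto
  qed
  finally have "ennreal 4 * (ennreal (?c * t powr p / 4) * g ?c) \<le> ennreal 4 * head_integral p g t"
    by (intro mult_left_mono) auto
  then show ?thesis
    using log_cut_pos[of p t] by (subst (asm) mult.assoc[symmetric], subst (asm) ennreal_mult[symmetric]) auto
qed

lemma measurable_on_unit_head_integral [measurable]:
  "on_unit (head_integral p g) \<in> borel_measurable borel"
proof -
  define \<Phi> where "\<Phi> v = (\<integral>\<^sup>+ \<sigma> \<in> {0<..<v}. g \<sigma> * ennreal ((1 - ln \<sigma>) powr (- 1)) \<partial>lborel)" for v :: real
  have "mono \<Phi>"
    unfolding \<Phi>_def by (intro monoI nn_integral_mono) (auto simp: indicator_def)
  note [measurable] = borel_measurable_mono_ennreal[OF this]
  have "on_unit (head_integral p g) = (\<lambda>t. if 0 < t \<and> t < 1 then \<Phi> (log_cut p t) else 0)"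
    by (auto simp: head_integral_def \<Phi>_def on_unit_def)
  also have "\<dots> \<in> borel_measurable borel"
    unfolding log_cut_def by measurable
  finally show ?thesis .
qed

text \<open>
  For \<open>m * u < 1\<close> the weight in the head at \<open>m * u\<close> is at least \<open>u powr p\<close> on the block. The last
  block, with \<open>m * u \<ge> 1\<close>, ends at \<open>1\<close>, and no parameter below \<open>1\<close> has a head that covers it. Here
  monotonicity helps: this block starts at \<open>exp (- 1)\<close> or later, so \<open>u powr p * g\<close> is bounded on it
  by a multiple of the head at \<open>u\<close> itself.
\<close>

lemma block_le_head_integral:
  fixes p u m :: real
  assumes p: "0 < p" and m: "m = 2 powr (1 / p)" and u: "0 < u" "u < 1" and g: "antimono g"
  defines "A \<equiv> on_unit (head_integral p g)"
  shows "ennreal (u powr p) * (\<integral>\<^sup>+ \<sigma> \<in> {log_cut p u..<min 1 (log_cut p (m * u))}. g \<sigma> \<partial>lborel)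
    \<le> A (m * u) + ennreal (4 * exp 1) * A u"
proof -
  note [measurable] = borel_measurable_antimono_ennreal[OF g]
  have m1: "1 < m" using p by (simp add: m)
  show ?thesis
  proof (cases "m * u < 1")
    case True
    have mu: "0 < m * u" using m1 u by simp
    have le1: "log_cut p (m * u) \<le> 1"
      using log_cut_less_1_iff[OF p mu] True by simp
    have "ennreal (u powr p) * (\<integral>\<^sup>+ \<sigma> \<in> {log_cut p u..<min 1 (log_cut p (m * u))}. g \<sigma> \<partial>lborel)
      = (\<integral>\<^sup>+ \<sigma>. ennreal (u powr p) * (g \<sigma> * indicator {log_cut p u..<log_cut p (m * u)} \<sigma>) \<partial>lborel)"
      using le1 by (simp add: nn_integral_cmult min_def)
    also have "\<dots> \<le> head_integral p g (m * u)"
      unfolding head_integral_def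
    proof (intro nn_integral_mono)
      fix \<sigma> :: real
      show "ennreal (u powr p) * (g \<sigma> * indicator {log_cut p u..<log_cut p (m * u)} \<sigma>)
        \<le> g \<sigma> * ennreal ((1 - ln \<sigma>) powr - 1) * indicator {0<..<log_cut p (m * u)} \<sigma>"
      proof (cases "log_cut p u \<le> \<sigma> \<and> \<sigma> < log_cut p (m * u)")
        case True
        then have "0 < \<sigma>" using log_cut_pos[of p u] by linarith
        moreover have "u powr p \<le> (1 - ln \<sigma>) powr - 1"
          using True u le1 \<open>0 < \<sigma>\<close> by (intro weight_between_cuts(2) p) auto
        ultimately show ?thesis
          using True by (simp add: mult.commute mult_left_mono ennreal_leI)
      qed auto
    qed
    also have "\<dots> = A (m * u)"
      using True mu by (simp add: A_def on_unit_def)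
    finally show ?thesis by (rule order_trans) simp
  next
    case False
    have "log_cut p (1 / m) \<le> log_cut p u"
      using False u m1 p by (subst log_cut_le_iff) (auto simp: field_simps)
    moreover have "log_cut p (1 / m) = exp (- 1)"
    proof -
      have "m powr p = 2" using p by (simp add: m powr_powr)
      then have "(1 / m) powr (- p) = 2"
        using m1 by (simp add: powr_minus powr_divide)
      then show ?thesis by (simp add: log_cut_def)
    qed
    ultimately have c: "exp (- 1) \<le> log_cut p u" by simp
    have "(\<integral>\<^sup>+ \<sigma> \<in> {log_cut p u..<min 1 (log_cut p (m * u))}. g \<sigma> \<partial>lborel)
      \<le> (\<integral>\<^sup>+ \<sigma>. g (log_cut p u) * indicator {0..<1::real} \<sigma> \<partial>lborel)"
    proof (intro nn_integral_mono)
      fix \<sigma>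
      show "g \<sigma> * indicator {log_cut p u..<min 1 (log_cut p (m * u))} \<sigma> \<le> g (log_cut p u) * indicator {0..<1} \<sigma>"
        using antimonoD[OF g, of "log_cut p u" \<sigma>] order_trans[OF log_cut_nonneg[of p u], of \<sigma>]
        by (auto simp: indicator_def)
    qed
    also have "\<dots> = g (log_cut p u)"
      by (simp add: nn_integral_cmult_indicator)
    finally have "ennreal (u powr p) * (\<integral>\<^sup>+ \<sigma> \<in> {log_cut p u..<min 1 (log_cut p (m * u))}. g \<sigma> \<partial>lborel)
      \<le> ennreal (u powr p) * g (log_cut p u)"
      by (intro mult_left_mono) auto
    also have "\<dots> \<le> ennreal (exp 1 * (log_cut p u * u powr p)) * g (log_cut p u)"
    proof (intro mult_right_mono ennreal_leI)
      have "exp 1 * exp (- 1) * u powr p \<le> exp 1 * log_cut p u * u powr p"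
        using c by (intro mult_right_mono mult_left_mono) auto
      then show "u powr p \<le> exp 1 * (log_cut p u * u powr p)"
        by (simp add: mult.assoc flip: exp_add)
    qed auto
    also have "\<dots> = ennreal (exp 1) * (ennreal (log_cut p u * u powr p) * g (log_cut p u))"
      using log_cut_pos[of p u] by (simp add: ennreal_mult mult.assoc)
    also have "\<dots> \<le> ennreal (exp 1) * (ennreal 4 * head_integral p g u)"
      using u by (intro mult_left_mono value_at_cut_le_head_integral p g) auto
    also have "\<dots> = ennreal (4 * exp 1) * A u"
    proof -
      have "ennreal (4 * exp 1) = ennreal (exp 1) * ennreal 4"
        by (subst ennreal_mult[symmetric]) auto
      then show ?thesis using u by (simp add: A_def on_unit_def mult.assoc)
    qed
    finally show ?thesis by (rule order_trans) simp
  qed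
qed

text \<open>
  The blocks between consecutive cuts at \<open>m ^ k * t\<close> exhaust the interval up to \<open>1\<close>. Since
  \<open>m powr p = 2\<close>, the factor \<open>t powr p\<close> is \<open>(1 / 2) ^ k\<close> times the \<open>p\<close>-th power of the parameter
  of the \<open>k\<close>-th block; this gives the geometric coefficients.
\<close>

lemma tail_integral_le_head_integrals:
  fixes p t m :: real
  assumes p: "0 < p" and m: "m = 2 powr (1 / p)" and t: "0 < t" "t < 1" and g: "antimono g"
  defines "A \<equiv> on_unit (head_integral p g)"
  shows "ennreal (t powr p) * (\<integral>\<^sup>+ \<sigma> \<in> {log_cut p t<..<1}. g \<sigma> \<partial>lborel)
    \<le> ennreal (2 + 4 * exp 1) * (\<Sum>k. ennreal ((1 / 2) ^ k) * A (m ^ k * t))"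
proof -
  note [measurable] = borel_measurable_antimono_ennreal[OF g]
  have m1: "1 < m" using p by (simp add: m)
  let ?u = "\<lambda>k. m ^ k * t"
  let ?B = "\<lambda>k. {log_cut p (?u k)..<min 1 (log_cut p (m * ?u k))}"
  have u0: "0 < ?u k" for k using m1 t by simp
  have tp: "t powr p = (1 / 2) ^ k * ?u k powr p" for k
  proof -
    have "(m ^ k) powr p = 2 ^ k"
      using p by (simp add: m powr_power powr_powr powr_realpow)
    then show ?thesis using m1 t by (simp add: powr_mult power_one_over)
  qed
  have "(\<integral>\<^sup>+ \<sigma> \<in> {log_cut p t<..<1}. g \<sigma> \<partial>lborel) \<le> (\<integral>\<^sup>+ \<sigma>. (\<Sum>k. g \<sigma> * indicator (?B k) \<sigma>) \<partial>lborel)"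
  proof (intro nn_integral_mono)
    fix \<sigma>
    show "g \<sigma> * indicator {log_cut p t<..<1} \<sigma> \<le> (\<Sum>k. g \<sigma> * indicator (?B k) \<sigma>)"
    proof (cases "log_cut p t < \<sigma> \<and> \<sigma> < 1")
      case True
      then have "0 < \<sigma>" using log_cut_pos[of p t] by linarith
      then obtain v where v: "0 < v" "v < 1" "\<sigma> = log_cut p v"
        using obtain_log_cut_eq[of p \<sigma>] True p by metis
      then have "t < v"
        using True p t by (simp add: log_cut_less_iff)
      then obtain k where k: "m ^ k \<le> v / t" "v / t < m ^ Suc k"
        using real_between_powers[OF m1, of "v / t"] t by auto
      then have "?u k \<le> v" "v < m * ?u k"
        using t by (auto simp: field_simps)
      then have "\<sigma> \<in> ?B k"
        using v u0[of k] p m1 True by (auto simp: log_cut_less_iff log_cut_le_iff)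
      then have "g \<sigma> * indicator {log_cut p t<..<1} \<sigma> \<le> g \<sigma> * indicator (?B k) \<sigma>"
        by (simp add: indicator_def)
      also have "\<dots> \<le> (\<Sum>k. g \<sigma> * indicator (?B k) \<sigma>)"
        by (rule suminf_ge_term)
      finally show ?thesis .
    qed auto
  qed
  also have "\<dots> = (\<Sum>k. \<integral>\<^sup>+ \<sigma> \<in> ?B k. g \<sigma> \<partial>lborel)"
    by (intro nn_integral_suminf) measurable
  finally have "ennreal (t powr p) * (\<integral>\<^sup>+ \<sigma> \<in> {log_cut p t<..<1}. g \<sigma> \<partial>lborel)
    \<le> (\<Sum>k. ennreal (t powr p) * (\<integral>\<^sup>+ \<sigma> \<in> ?B k. g \<sigma> \<partial>lborel))"
    by (simp add: mult_left_mono)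
  also have "\<dots> \<le> (\<Sum>k. ennreal ((1 / 2) ^ k) * (A (m * ?u k) + ennreal (4 * exp 1) * A (?u k)))"
  proof (intro suminf_le)
    fix k
    show "ennreal (t powr p) * (\<integral>\<^sup>+ \<sigma> \<in> ?B k. g \<sigma> \<partial>lborel)
      \<le> ennreal ((1 / 2) ^ k) * (A (m * ?u k) + ennreal (4 * exp 1) * A (?u k))"
    proof (cases "?u k < 1")
      case True
      have "ennreal (t powr p) * (\<integral>\<^sup>+ \<sigma> \<in> ?B k. g \<sigma> \<partial>lborel)
        = ennreal ((1 / 2) ^ k) * (ennreal (?u k powr p) * (\<integral>\<^sup>+ \<sigma> \<in> ?B k. g \<sigma> \<partial>lborel))"
        by (subst tp[of k], subst ennreal_mult) (auto simp: mult.assoc)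
      also have "\<dots> \<le> ennreal ((1 / 2) ^ k) * (A (m * ?u k) + ennreal (4 * exp 1) * A (?u k))"
        unfolding A_def by (intro mult_left_mono block_le_head_integral p m u0 True g) auto
      finally show ?thesis .
    next
      case False
      then have "1 \<le> log_cut p (?u k)"
        using log_cut_less_1_iff[OF p u0[of k]] by simp
      then have empty: "?B k = {}" by auto
      show ?thesis unfolding empty by simp
    qed
  qed auto
  also have "\<dots> = (\<Sum>k. ennreal 2 * (ennreal ((1 / 2) ^ Suc k) * A (?u (Suc k))))
      + (\<Sum>k. ennreal (4 * exp 1) * (ennreal ((1 / 2) ^ k) * A (?u k)))"
  proof (subst suminf_add)
    show "(\<Sum>k. ennreal ((1 / 2) ^ k) * (A (m * ?u k) + ennreal (4 * exp 1) * A (?u k)))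
      = (\<Sum>k. ennreal 2 * (ennreal ((1 / 2) ^ Suc k) * A (?u (Suc k)))
          + ennreal (4 * exp 1) * (ennreal ((1 / 2) ^ k) * A (?u k)))"
    proof (intro suminf_cong)
      fix k
      have "ennreal 2 * (ennreal ((1 / 2) ^ Suc k) * A (?u (Suc k))) = ennreal ((1 / 2) ^ k) * A (m * ?u k)"
      proof -
        have "ennreal 2 * ennreal ((1 / 2) ^ Suc k) = ennreal ((1 / 2) ^ k)"
          by (subst ennreal_mult[symmetric]) auto
        then show ?thesis by (simp only: mult.assoc[symmetric] power_Suc)
      qed
      then show "ennreal ((1 / 2) ^ k) * (A (m * ?u k) + ennreal (4 * exp 1) * A (?u k))
        = ennreal 2 * (ennreal ((1 / 2) ^ Suc k) * A (?u (Suc k)))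
          + ennreal (4 * exp 1) * (ennreal ((1 / 2) ^ k) * A (?u k))"
        by (simp only: distrib_left mult.left_commute)
    qed
  qed auto
  also have "\<dots> \<le> ennreal 2 * (\<Sum>k. ennreal ((1 / 2) ^ k) * A (?u k))
      + ennreal (4 * exp 1) * (\<Sum>k. ennreal ((1 / 2) ^ k) * A (?u k))"
    unfolding ennreal_suminf_cmult by (intro add_mono mult_left_mono suminf_Suc_le order_refl) auto
  also have "\<dots> = ennreal (2 + 4 * exp 1) * (\<Sum>k. ennreal ((1 / 2) ^ k) * A (?u k))"
    by (subst ennreal_plus) (auto simp: distrib_right)
  finally show ?thesis .
qed

section \<open>The Gamma quasinorm in the logarithmic scale\<close>

text \<open>
  The substitution \<open>v = log_cut p t\<close> on compact intervals away from \<open>0\<close>, followed by exhaustion.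
\<close>

lemma nn_integral_log_cut_substitution:
  fixes H :: "real \<Rightarrow> ennreal"
  assumes p: "0 < p" and [measurable]: "H \<in> borel_measurable borel"
  shows "(\<integral>\<^sup>+ v \<in> {0<..<1}. H v \<partial>lborel)
    = (\<integral>\<^sup>+ t \<in> {0<..<1}. H (log_cut p t) * ennreal (log_cut p t * (p * t powr (- p - 1))) \<partial>lborel)"
proof -
  let ?d = "\<lambda>t. log_cut p t * (p * t powr (- p - 1))"
  have [measurable]: "log_cut p \<in> borel_measurable borel"
    unfolding log_cut_def[abs_def] by measurable
  let ?\<mu> = "density lborel H" and ?\<nu> = "density lborel (\<lambda>t. H (log_cut p t) * ennreal (?d t))"
  define a where "a n = 1 / real (n + 2)" for n
  have a: "0 < a n" "a n < 1" "a (Suc n) \<le> a n" for n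
    by (auto simp: a_def frac_le)
  have eq: "emeasure ?\<mu> {log_cut p (a n)..1} = emeasure ?\<nu> {a n..1}" for n
  proof -
    have "(\<integral>\<^sup>+ v. H v * indicator {log_cut p (a n)..log_cut p 1} v \<partial>lborel)
      = (\<integral>\<^sup>+ t. H (log_cut p t) * ennreal (?d t) * indicator {a n..1} t \<partial>lborel)"
    proof (rule nn_integral_substitution_aux)
      fix t assume "t \<in> {a n..1}"
      then have t: "0 < t" using a[of n] by auto
      show "(log_cut p has_real_derivative ?d t) (at t)"
        unfolding log_cut_def[abs_def] using t
        by (auto intro!: derivative_eq_intros simp: powr_diff)
      show "0 \<le> ?d t"
        using p t by (simp add: less_imp_le[OF log_cut_pos])
    next
      show "continuous_on {a n..1} ?d"
        unfolding log_cut_def using a[of n] by (intro continuous_intros) auto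
    qed (use a[of n] in auto)
    then show ?thesis by (simp add: emeasure_density)
  qed
  have "emeasure ?\<mu> (\<Union>n. {log_cut p (a n)..1}) = (SUP n. emeasure ?\<mu> {log_cut p (a n)..1})"
    using a p by (intro SUP_emeasure_incseq[symmetric] incseq_SucI)
       (auto intro: order_trans[rotated] simp: log_cut_le_iff)
  also have "\<dots> = (SUP n. emeasure ?\<nu> {a n..1})"
    by (simp add: eq)
  also have "\<dots> = emeasure ?\<nu> (\<Union>n. {a n..1})"
    using a by (intro SUP_emeasure_incseq incseq_SucI) (auto intro: order_trans[rotated])
  finally have main: "emeasure ?\<mu> (\<Union>n. {log_cut p (a n)..1}) = emeasure ?\<nu> (\<Union>n. {a n..1})" .
  have ex: "\<exists>n. a n \<le> t" if "0 < t" for t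
  proof -
    obtain n where "inverse (real (Suc n)) < t" using reals_Archimedean[OF \<open>0 < t\<close>] by auto
    moreover have "a n \<le> inverse (real (Suc n))" by (auto simp: a_def divide_simps)
    ultimately show ?thesis by (auto intro: exI[of _ n])
  qed
  have "(\<Union>n. {a n..1}) = {0<..1}"
    using a ex by (fastforce intro: less_le_trans)
  moreover have "(\<Union>n. {log_cut p (a n)..1}) = {0<..1}"
  proof (intro equalityI subsetI)
    fix v :: real assume v: "v \<in> {0<..1}"
    show "v \<in> (\<Union>n. {log_cut p (a n)..1})"
    proof (cases "v = 1")
      case True
      then show ?thesis using a[of 0] p log_cut_less_1_iff[of p "a 0"] by (auto intro!: exI[of _ 0])
    next
      case False
      then obtain t where t: "0 < t" "v = log_cut p t"
        using obtain_log_cut_eq[OF p, of v] v by auto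
      then show ?thesis
        using ex[OF t(1)] v a p by (auto simp: log_cut_le_iff)
    qed
  qed (auto intro: less_le_trans[OF log_cut_pos])
  ultimately have "(\<integral>\<^sup>+ v \<in> {0<..1}. H v \<partial>lborel)
    = (\<integral>\<^sup>+ t \<in> {0<..1}. H (log_cut p t) * ennreal (?d t) \<partial>lborel)"
    using main by (simp add: emeasure_density)
  moreover have "(\<integral>\<^sup>+ v \<in> {0<..1}. F v \<partial>lborel) = (\<integral>\<^sup>+ v \<in> {0<..<1}. F v \<partial>lborel)" for F :: "real \<Rightarrow> ennreal"
    using AE_lborel_singleton[of 1] by (intro nn_integral_cong_AE) (auto elim!: eventually_mono simp: indicator_def)
  ultimately show ?thesis by simp
qed

text \<open>
  At \<open>v = log_cut p t\<close> the factor \<open>1 / v\<close> of the weight cancels against the same factor in the derivative of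
  the cut, and the powers of \<open>1 - ln v = t powr (- p)\<close> combine with the rest of it to the homogeneous weight in \<open>t\<close>.
\<close>

lemma GGamma_integral_eq:
  fixes p a q :: real
  assumes p: "0 < p"
  defines "A \<equiv> \<lambda>g. on_unit (head_integral p g)"
  shows "(\<integral>\<^sup>+ v \<in> {0<..<1}. ennreal (v powr (- 1) * (1 - ln v) powr (a / p - 1)) *
      epowr (\<integral>\<^sup>+ \<sigma> \<in> {0<..<v}. g \<sigma> * ennreal ((1 - ln \<sigma>) powr (- 1)) \<partial>lborel) q \<partial>lborel)
    = ennreal p * scale_integral a q (A g)"
proof -
  define \<Phi> where "\<Phi> v = (\<integral>\<^sup>+ \<sigma> \<in> {0<..<v}. g \<sigma> * ennreal ((1 - ln \<sigma>) powr (- 1)) \<partial>lborel)" for v :: real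
  have "mono \<Phi>"
    unfolding \<Phi>_def by (intro monoI nn_integral_mono) (auto simp: indicator_def)
  note [measurable] = borel_measurable_mono_ennreal[OF this]
  have [measurable]: "A g \<in> borel_measurable borel"
    unfolding A_def by measurable
  let ?H = "\<lambda>v. ennreal (v powr (- 1) * (1 - ln v) powr (a / p - 1)) * epowr (\<Phi> v) q"
  have "(\<integral>\<^sup>+ v \<in> {0<..<1}. ?H v \<partial>lborel)
    = (\<integral>\<^sup>+ t \<in> {0<..<1}. ?H (log_cut p t) * ennreal (log_cut p t * (p * t powr (- p - 1))) \<partial>lborel)"
    by (intro nn_integral_log_cut_substitution p) measurable
  also have "\<dots> = (\<integral>\<^sup>+ t. ennreal p * (ennreal (t powr (- a - 1)) * epowr (A g t) q * indicator {0<..} t) \<partial>lborel)"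
  proof (intro nn_integral_cong)
    fix t :: real
    show "?H (log_cut p t) * ennreal (log_cut p t * (p * t powr (- p - 1))) * indicator {0<..<1} t
      = ennreal p * (ennreal (t powr (- a - 1)) * epowr (A g t) q * indicator {0<..} t)"
    proof (cases "0 < t \<and> t < 1")
      case True
      let ?c = "log_cut p t"
      have "(1 - ln ?c) powr (a / p - 1) = t powr (- a + p)"
      proof -
        have "- p * (a / p - 1) = - a + p" using p by (simp add: field_simps)
        then show ?thesis by (simp only: one_minus_ln_log_cut powr_powr)
      qed
      then have "?c powr (- 1) * (1 - ln ?c) powr (a / p - 1) * (?c * (p * t powr (- p - 1)))
        = p * (t powr (- a + p) * t powr (- p - 1))"
        using abs_of_pos[OF log_cut_pos[of p t]] by (simp add: powr_minus field_simps)
      also have "\<dots> = p * t powr (- a - 1)"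
        by (simp flip: powr_add)
      finally have w: "?c powr (- 1) * (1 - ln ?c) powr (a / p - 1) * (?c * (p * t powr (- p - 1)))
        = p * t powr (- a - 1)" .
      have "?H ?c * ennreal (?c * (p * t powr (- p - 1)))
        = ennreal (?c powr (- 1) * (1 - ln ?c) powr (a / p - 1) * (?c * (p * t powr (- p - 1)))) * epowr (\<Phi> ?c) q"
        using p log_cut_pos[of p t] by (subst ennreal_mult[of "_ * _"]) (auto simp: mult_ac)
      also have "\<dots> = ennreal p * (ennreal (t powr (- a - 1)) * epowr (\<Phi> ?c) q)"
        using p unfolding w by (simp add: ennreal_mult mult.assoc)
      finally show ?thesis
        using True by (simp add: \<Phi>_def A_def on_unit_def head_integral_def)
    next
      case False
      then show ?thesis by (auto simp: A_def on_unit_def indicator_def)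
    qed
  qed
  also have "\<dots> = ennreal p * scale_integral a q (A g)"
    unfolding scale_integral_def by (intro nn_integral_cmult) measurable
  finally show ?thesis by (simp add: \<Phi>_def)
qed

section \<open>The K-functional\<close>

lemma elems_Lebesgue_space:
  "elems (Lebesgue_space M p) = {f \<in> borel_measurable M. qnorm (Lebesgue_space M p) f < \<infinity>}"
  by (simp add: Lebesgue_space_def space_of_qnorm_def)

lemma elems_grand_Lebesgue_space:
  "elems (grand_Lebesgue_space M p)
    = {f \<in> borel_measurable M. qnorm (grand_Lebesgue_space M p) f < \<infinity>}"
  by (simp add: grand_Lebesgue_space_def space_of_qnorm_def)

lemma epowr_qnorm_Lebesgue_space:
  assumes "f \<in> borel_measurable M" "emeasure M (space M) = 1" "0 < p"
  shows "epowr (qnorm (Lebesgue_space M p) f) p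
    = (\<integral>\<^sup>+ \<sigma> \<in> {0<..<1}. epowr (decr_rearr M f \<sigma>) p \<partial>lborel)"
  using assms by (simp add: Lebesgue_space_def space_of_qnorm_def epowr_epowr nn_integral_decr_rearr)

text \<open>
  With the \<open>p\<close>-th powers on both sides the supremum is a family of linear estimates of the integral.
\<close>

lemma grand_Lebesgue_le_iff:
  assumes p: "0 < p"
  shows "qnorm (grand_Lebesgue_space M p) f \<le> epowr X (1 / p) \<longleftrightarrow>
    (\<forall>s\<in>{0<..<1}. (\<integral>\<^sup>+ \<sigma> \<in> {s<..<1}. epowr (decr_rearr M f \<sigma>) p \<partial>lborel) \<le> ennreal (1 - ln s) * X)"
proof -
  have "ennreal ((1 - ln s) powr (- 1 / p)) * epowr Y (1 / p) \<le> epowr X (1 / p) \<longleftrightarrow> Y \<le> ennreal (1 - ln s) * X"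
    if s: "s \<in> {0<..<1}" for s Y
  proof -
    have "0 < s" "s \<le> 1" using s by auto
    then have ln: "0 < 1 - ln s" using one_minus_ln_pos[of s] by linarith
    have "ennreal ((1 - ln s) powr (- 1 / p)) * epowr Y (1 / p) = epowr (ennreal ((1 - ln s) powr (- 1)) * Y) (1 / p)"
      unfolding epowr_mult by (subst epowr_ennreal, simp, subst powr_powr, simp)
    also have "\<dots> \<le> epowr X (1 / p) \<longleftrightarrow> ennreal ((1 - ln s) powr (- 1)) * Y \<le> X"
      using p by (subst epowr_le_iff) (auto simp: epowr_epowr)
    also have "\<dots> \<longleftrightarrow> ennreal (1 - ln s) * (ennreal ((1 - ln s) powr (- 1)) * Y) \<le> ennreal (1 - ln s) * X"
      using ln by (subst ennreal_mult_le_mult_iff) auto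
    also have "ennreal (1 - ln s) * (ennreal ((1 - ln s) powr (- 1)) * Y) = Y"
    proof -
      have "(1 - ln s) * (1 - ln s) powr (- 1) = 1"
        using ln by (simp add: powr_minus)
      then have "ennreal (1 - ln s) * ennreal ((1 - ln s) powr (- 1)) = 1"
        using ln by (subst ennreal_mult[symmetric]) auto
      then show ?thesis by (simp only: mult.assoc[symmetric] mult_1)
    qed
    finally show ?thesis .
  qed
  then show ?thesis
    unfolding grand_Lebesgue_space_def space_of_qnorm_def by (simp add: SUP_le_iff)
qed

text \<open>
  Let \<open>f = f0 + f1\<close>. Then the rearrangement of \<open>f\<close> at \<open>\<sigma>\<close> is at most the sum of those of \<open>f0\<close> and
  \<open>f1\<close> at \<open>\<sigma> / 2\<close>. The part from \<open>f1\<close> is bounded by the full \<open>L\<^sup>p\<close> norm. The part from \<open>f0\<close> lives to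
  the right of half the left end of the block, where the logarithmic factor of the grand norm is at
  most a multiple of \<open>t powr (- p)\<close>; it is for this that the block must not reach down to \<open>0\<close>.
\<close>

lemma block_le_decomposition:
  assumes p: "0 < p" and one: "emeasure M (space M) = 1"
    and [measurable]: "f \<in> borel_measurable M"
    and d: "(f0, f1) \<in> decompositions M (grand_Lebesgue_space M p) (Lebesgue_space M p) f"
    and t: "0 < t" "t < 1"
  shows "ennreal (t powr p) * (\<integral>\<^sup>+ \<sigma> \<in> {log_cut p (t / 2 powr (1 / p))<..log_cut p t}. epowr (decr_rearr M f \<sigma>) p \<partial>lborel)
    \<le> ennreal (10 * 2 powr p) *
      epowr (qnorm (grand_Lebesgue_space M p) f0 + ennreal t * qnorm (Lebesgue_space M p) f1) p"
proof -
  define m :: real where "m = 2 powr (1 / p)"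
  have mp: "0 < m" "m powr p = 2" using p by (auto simp: m_def powr_powr)
  have [measurable]: "f0 \<in> borel_measurable M" "f1 \<in> borel_measurable M"
    and f: "AE x in M. f x = f0 x + f1 x"
    using d by (auto simp: decompositions_def elems_Lebesgue_space elems_grand_Lebesgue_space)
  let ?N0 = "qnorm (grand_Lebesgue_space M p) f0" and ?N1 = "qnorm (Lebesgue_space M p) f1"
  let ?g = "\<lambda>h \<sigma>. epowr (decr_rearr M h \<sigma>) p"
  let ?s = "log_cut p (t / m)"
  let ?c = "log_cut p t"
  have c1: "?c < 1" using log_cut_less_1_iff[OF p t(1)] t by simp
  have "1 < m" using p by (simp add: m_def)
  then have "t / m < 1" using t by (simp add: field_simps)
  then have s1: "?s < 1" using log_cut_less_1_iff[OF p, of "t / m"] t mp by simp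
  \<comment> \<open>Sublinearity of the rearrangement costs a factor \<open>2\<close> in the argument, which is undone by a dilation.\<close>
  have half: "(\<integral>\<^sup>+ \<sigma> \<in> {?s<..?c}. ?g h (\<sigma> / 2) \<partial>lborel) \<le> ennreal 2 * (\<integral>\<^sup>+ \<sigma> \<in> {?s / 2<..<1}. ?g h \<sigma> \<partial>lborel)" for h
  proof -
    have "(\<integral>\<^sup>+ \<sigma>. ?g h (\<sigma> / 2) * indicator {?s<..?c} \<sigma> \<partial>lborel)
      = ennreal \<bar>2\<bar> * (\<integral>\<^sup>+ \<sigma>. ?g h ((0 + 2 * \<sigma>) / 2) * indicator {?s<..?c} (0 + 2 * \<sigma>) \<partial>lborel)"
      by (intro nn_integral_real_affine) auto
    also have "\<dots> \<le> ennreal 2 * (\<integral>\<^sup>+ \<sigma> \<in> {?s / 2<..<1}. ?g h \<sigma> \<partial>lborel)"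
      using c1 by (auto intro!: mult_left_mono nn_integral_mono simp: indicator_def)
    finally show ?thesis .
  qed
  have I0: "(\<integral>\<^sup>+ \<sigma> \<in> {?s<..?c}. ?g f0 (\<sigma> / 2) \<partial>lborel) \<le> ennreal (8 * t powr (- p)) * epowr ?N0 p"
  proof -
    have s2: "?s / 2 \<in> {0<..<1}" using s1 log_cut_pos[of p "t / m"] by auto
    have tm: "(t / m) powr (- p) = 2 * t powr (- p)"
      using t mp by (simp add: powr_divide powr_minus field_simps)
    have "1 \<le> (t / m) powr (- p)"
      using one_minus_ln_pos[OF log_cut_pos[of p "t / m"]] s1 unfolding one_minus_ln_log_cut by simp
    moreover have "ln (?s / 2) = ln ?s - ln 2" by (simp add: ln_div)
    moreover have "ln 2 \<le> (1::real)" using ln_le_minus_one[of "2::real"] by simp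
    ultimately have ls: "1 - ln (?s / 2) \<le> 4 * t powr (- p)"
      using one_minus_ln_log_cut[of p "t / m"] tm by linarith
    have "?N0 \<le> epowr (epowr ?N0 p) (1 / p)"
      using p by (simp add: epowr_epowr)
    then have "(\<integral>\<^sup>+ \<sigma> \<in> {?s / 2<..<1}. ?g f0 \<sigma> \<partial>lborel) \<le> ennreal (1 - ln (?s / 2)) * epowr ?N0 p"
      using s2 by (subst (asm) grand_Lebesgue_le_iff[OF p]) blast
    also have "\<dots> \<le> ennreal (4 * t powr (- p)) * epowr ?N0 p"
      using ls by (intro mult_right_mono ennreal_leI) auto
    finally have "ennreal 2 * (\<integral>\<^sup>+ \<sigma> \<in> {?s / 2<..<1}. ?g f0 \<sigma> \<partial>lborel) \<le> ennreal 2 * (ennreal (4 * t powr (- p)) * epowr ?N0 p)"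
      by (intro mult_left_mono) auto
    also have "\<dots> = ennreal (8 * t powr (- p)) * epowr ?N0 p"
      by (simp only: mult.assoc[symmetric], subst ennreal_mult[symmetric]) auto
    finally show ?thesis using half[of f0] by (rule order_trans[rotated])
  qed
  have I1: "(\<integral>\<^sup>+ \<sigma> \<in> {?s<..?c}. ?g f1 (\<sigma> / 2) \<partial>lborel) \<le> ennreal 2 * epowr ?N1 p"
  proof -
    have "(\<integral>\<^sup>+ \<sigma> \<in> {?s / 2<..<1}. ?g f1 \<sigma> \<partial>lborel) \<le> (\<integral>\<^sup>+ \<sigma> \<in> {0<..<1}. ?g f1 \<sigma> \<partial>lborel)"
    proof (intro nn_integral_mono)
      fix \<sigma> :: real
      show "?g f1 \<sigma> * indicator {?s / 2<..<1} \<sigma> \<le> ?g f1 \<sigma> * indicator {0<..<1} \<sigma>"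
        using less_trans[of 0 "?s / 2" \<sigma>] by (auto simp: indicator_def)
    qed
    also have "\<dots> = epowr ?N1 p"
      using p one by (simp add: epowr_qnorm_Lebesgue_space)
    finally have "ennreal 2 * (\<integral>\<^sup>+ \<sigma> \<in> {?s / 2<..<1}. ?g f1 \<sigma> \<partial>lborel) \<le> ennreal 2 * epowr ?N1 p"
      by (intro mult_left_mono) auto
    then show ?thesis using half[of f1] by (rule order_trans[rotated])
  qed
  have "(\<integral>\<^sup>+ \<sigma> \<in> {?s<..?c}. ?g f \<sigma> \<partial>lborel)
    \<le> (\<integral>\<^sup>+ \<sigma>. ennreal (2 powr p) * (?g f0 (\<sigma> / 2) * indicator {?s<..?c} \<sigma> + ?g f1 (\<sigma> / 2) * indicator {?s<..?c} \<sigma>) \<partial>lborel)"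
  proof (intro nn_integral_mono)
    fix \<sigma>
    show "?g f \<sigma> * indicator {?s<..?c} \<sigma> \<le> ennreal (2 powr p) * (?g f0 (\<sigma> / 2) * indicator {?s<..?c} \<sigma> + ?g f1 (\<sigma> / 2) * indicator {?s<..?c} \<sigma>)"
    proof (cases "\<sigma> \<in> {?s<..?c}")
      case True
      then have "0 < \<sigma>" using less_trans[OF log_cut_pos] by auto
      then have "decr_rearr M f (\<sigma> / 2 + \<sigma> / 2) \<le> decr_rearr M f0 (\<sigma> / 2) + decr_rearr M f1 (\<sigma> / 2)"
        by (intro decr_rearr_add_le f) auto
      then have "?g f \<sigma> \<le> epowr (decr_rearr M f0 (\<sigma> / 2) + decr_rearr M f1 (\<sigma> / 2)) p"
        using p by (intro epowr_mono) auto
      also have "\<dots> \<le> ennreal (2 powr p) * (?g f0 (\<sigma> / 2) + ?g f1 (\<sigma> / 2))"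
        using p by (intro epowr_add_le) auto
      finally show ?thesis using True by simp
    qed simp
  qed
  also have "\<dots> = ennreal (2 powr p) * ((\<integral>\<^sup>+ \<sigma> \<in> {?s<..?c}. ?g f0 (\<sigma> / 2) \<partial>lborel) + (\<integral>\<^sup>+ \<sigma> \<in> {?s<..?c}. ?g f1 (\<sigma> / 2) \<partial>lborel))"
    by (simp add: nn_integral_cmult nn_integral_add)
  also have "\<dots> \<le> ennreal (2 powr p) * (ennreal (8 * t powr (- p)) * epowr ?N0 p + ennreal 2 * epowr ?N1 p)"
    by (intro mult_left_mono add_mono I0 I1) auto
  finally have "ennreal (t powr p) * (\<integral>\<^sup>+ \<sigma> \<in> {?s<..?c}. ?g f \<sigma> \<partial>lborel)
    \<le> ennreal (t powr p) * (ennreal (2 powr p) * (ennreal (8 * t powr (- p)) * epowr ?N0 p + ennreal 2 * epowr ?N1 p))"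
    by (intro mult_left_mono) auto
  also have "\<dots> = ennreal (2 powr p) * (ennreal 8 * epowr ?N0 p + ennreal 2 * (ennreal (t powr p) * epowr ?N1 p))"
  proof -
    have "t powr p * (8 * t powr (- p)) = 8"
      using t by (simp add: powr_minus)
    then have "ennreal (t powr p) * ennreal (8 * t powr (- p)) = ennreal 8"
      by (subst ennreal_mult[symmetric], simp, simp, simp only:)
    then have e: "ennreal (t powr p) * (ennreal (8 * t powr (- p)) * epowr ?N0 p) = ennreal 8 * epowr ?N0 p"
      by (simp only: mult.assoc[symmetric])
    have "ennreal (t powr p) * (ennreal (2 powr p) * (ennreal (8 * t powr (- p)) * epowr ?N0 p + ennreal 2 * epowr ?N1 p))
      = ennreal (2 powr p) * (ennreal (t powr p) * (ennreal (8 * t powr (- p)) * epowr ?N0 p) + ennreal 2 * (ennreal (t powr p) * epowr ?N1 p))"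
      by (simp only: distrib_left mult.left_commute)
    then show ?thesis unfolding e .
  qed
  also have "\<dots> \<le> ennreal (2 powr p) * (ennreal 8 * epowr (?N0 + ennreal t * ?N1) p + ennreal 2 * epowr (?N0 + ennreal t * ?N1) p)"
  proof (intro mult_left_mono add_mono)
    show "epowr ?N0 p \<le> epowr (?N0 + ennreal t * ?N1) p"
      using p by (intro epowr_mono) auto
    have "ennreal (t powr p) * epowr ?N1 p = epowr (ennreal t * ?N1) p"
      using t by (simp add: epowr_mult epowr_ennreal)
    also have "\<dots> \<le> epowr (?N0 + ennreal t * ?N1) p"
      using p by (intro epowr_mono) auto
    finally show "ennreal (t powr p) * epowr ?N1 p \<le> epowr (?N0 + ennreal t * ?N1) p" .
  qed auto
  also have "\<dots> = ennreal (10 * 2 powr p) * epowr (?N0 + ennreal t * ?N1) p"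
  proof -
    have "ennreal (10 * 2 powr p) = ennreal (2 powr p) * (ennreal 8 + ennreal 2)"
      by (subst ennreal_plus[symmetric], simp, simp, subst ennreal_mult[symmetric]) (auto simp: mult.commute)
    then show ?thesis by (simp only: distrib_right mult.assoc)
  qed
  finally show ?thesis by (simp add: m_def)
qed

lemma block_le_K_functional:
  assumes p: "0 < p" and one: "emeasure M (space M) = 1"
    and f: "f \<in> borel_measurable M" and t: "0 < t" "t < 1"
  shows "ennreal (t powr p) * (\<integral>\<^sup>+ \<sigma> \<in> {log_cut p (t / 2 powr (1 / p))<..log_cut p t}. epowr (decr_rearr M f \<sigma>) p \<partial>lborel)
    \<le> ennreal (10 * 2 powr p) *
      epowr (K_functional M (grand_Lebesgue_space M p) (Lebesgue_space M p) f t) p"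
    (is "?L \<le> ennreal ?C * epowr ?K p")
proof -
  have C: "0 < ?C" by simp
  have "epowr (ennreal (1 / ?C) * ?L) (1 / p) \<le> ?K"
    unfolding K_functional_def
  proof (intro INF_greatest)
    fix d assume d: "d \<in> decompositions M (grand_Lebesgue_space M p) (Lebesgue_space M p) f"
    obtain f0 f1 where [simp]: "d = (f0, f1)" by (cases d)
    let ?n = "qnorm (grand_Lebesgue_space M p) f0 + ennreal t * qnorm (Lebesgue_space M p) f1"
    have "ennreal (1 / ?C) * ?L \<le> ennreal (1 / ?C) * (ennreal ?C * epowr ?n p)"
      using d by (intro mult_left_mono block_le_decomposition[OF p one f _ t]) auto
    also have "\<dots> = epowr ?n p"
      using C by (simp only: mult.assoc[symmetric], subst ennreal_mult[symmetric]) auto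
    finally have "epowr (ennreal (1 / ?C) * ?L) (1 / p) \<le> ?n"
      using p by (subst epowr_le_iff) auto
    then show "epowr (ennreal (1 / ?C) * ?L) (1 / p) \<le> (case d of (f0, f1) \<Rightarrow> qnorm (grand_Lebesgue_space M p) f0 + ennreal t * qnorm (Lebesgue_space M p) f1)"
      by simp
  qed
  then have "ennreal (1 / ?C) * ?L \<le> epowr ?K p"
    using p by (subst (asm) epowr_le_iff) auto
  then have "ennreal ?C * (ennreal (1 / ?C) * ?L) \<le> ennreal ?C * epowr ?K p"
    by (intro mult_left_mono) auto
  moreover have "ennreal ?C * (ennreal (1 / ?C) * ?L) = ?L"
    using C by (simp only: mult.assoc[symmetric], subst ennreal_mult[symmetric]) auto
  ultimately show ?thesis by simp
qed

text \<open>
  The function is truncated at the height \<open>c\<close> of its rearrangement at \<open>h = log_cut p t\<close>. The excess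
  \<open>f0\<close> has a rearrangement supported in \<open>(0, h)\<close>, and \<open>1 - ln s\<close> dominates \<open>1 - ln \<sigma>\<close> for \<open>s < \<sigma>\<close>, so
  its grand norm is bounded by the head. The \<open>L\<^sup>p\<close> norm of the truncation \<open>f1\<close> consists of the tail and
  of the constant \<open>c\<close> on \<open>(0, h)\<close>, which is controlled by the head again. If the right side is
  infinite there is nothing to show; if it is finite, both pieces lie in the respective spaces.
\<close>

lemma K_functional_le_head_tail:
  assumes p: "0 < p" and one: "emeasure M (space M) = 1"
    and [measurable]: "f \<in> borel_measurable M" and t: "0 < t" "t < 1"
  defines "g \<equiv> \<lambda>\<sigma>. epowr (decr_rearr M f \<sigma>) p"
  shows "epowr (K_functional M (grand_Lebesgue_space M p) (Lebesgue_space M p) f t) p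
    \<le> ennreal (2 powr p) * (ennreal 5 * head_integral p g t
        + ennreal (t powr p) * (\<integral>\<^sup>+ \<sigma> \<in> {log_cut p t<..<1}. g \<sigma> \<partial>lborel))"
proof -
  let ?X0 = "grand_Lebesgue_space M p" and ?X1 = "Lebesgue_space M p"
  let ?h = "log_cut p t"
  let ?A = "head_integral p g t"
  let ?T = "\<integral>\<^sup>+ \<sigma> \<in> {?h<..<1}. g \<sigma> \<partial>lborel"
  have h: "0 < ?h" "?h < 1"
    using log_cut_less_1_iff[OF p t(1)] t by auto
  have g: "antimono g"
    unfolding g_def using p by (intro antimonoI epowr_mono decr_rearr_antimono) auto
  note [measurable] = borel_measurable_antimono_ennreal[OF g]
  show ?thesis
  proof (cases "?A = \<infinity> \<or> ?T = \<infinity>")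
    case True
    then have "ennreal (2 powr p) * (ennreal 5 * ?A + ennreal (t powr p) * ?T) = \<infinity>"
      using t by (auto simp: ennreal_mult_eq_top_iff)
    then show ?thesis by simp
  next
    case False
    have "decr_rearr M f ?h < \<infinity>"
      using one h by (intro decr_rearr_finite) auto
    then obtain c where c: "0 \<le> c" "decr_rearr M f ?h = ennreal c"
      by (cases "decr_rearr M f ?h") auto
    define f1 where "f1 x = max (- c) (min c (f x))" for x
    define f0 where "f0 x = f x - f1 x" for x
    have [measurable]: "f1 \<in> borel_measurable M" "f0 \<in> borel_measurable M"
      unfolding f0_def[abs_def] f1_def[abs_def] by measurable
    have f1: "\<bar>f1 x\<bar> \<le> \<bar>f x\<bar>" "\<bar>f1 x\<bar> \<le> c" and f0: "\<bar>f0 x\<bar> \<le> \<bar>f x\<bar>" "f0 x \<noteq> 0 \<Longrightarrow> c < \<bar>f x\<bar>" for x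
      using c(1) by (auto simp: f1_def f0_def)
    have r0: "epowr (decr_rearr M f0 \<sigma>) p \<le> g \<sigma>" for \<sigma>
      unfolding g_def using p f0 by (intro epowr_mono decr_rearr_mono) auto
    have r1: "epowr (decr_rearr M f1 \<sigma>) p \<le> g \<sigma>" for \<sigma>
      unfolding g_def using p f1 by (intro epowr_mono decr_rearr_mono) auto
    have r1': "epowr (decr_rearr M f1 \<sigma>) p \<le> g ?h" for \<sigma>
      unfolding g_def c(2) using p f1 c(1) by (intro epowr_mono decr_rearr_le_bound) auto
    have z0: "decr_rearr M f0 \<sigma> = 0" if \<sigma>: "?h \<le> \<sigma>" for \<sigma>
    proof -
      have "emeasure M {x \<in> space M. 0 < \<bar>f0 x\<bar>} \<le> emeasure M {x \<in> space M. c < \<bar>f x\<bar>}"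
        using f0 by (intro emeasure_mono) auto
      also have "\<dots> \<le> ennreal ?h"
        using c by (simp flip: decr_rearr_le_iff)
      also have "\<dots> \<le> ennreal \<sigma>" using \<sigma> by (rule ennreal_leI)
      finally have "decr_rearr M f0 \<sigma> \<le> ennreal 0"
        by (subst decr_rearr_le_iff) auto
      then show ?thesis by simp
    qed
    have N0: "qnorm ?X0 f0 \<le> epowr ?A (1 / p)"
      unfolding grand_Lebesgue_le_iff[OF p]
    proof
      fix s :: real assume s: "s \<in> {0<..<1}"
      have L: "1 \<le> 1 - ln s" using s by auto
      have "(\<integral>\<^sup>+ \<sigma> \<in> {s<..<1}. epowr (decr_rearr M f0 \<sigma>) p \<partial>lborel)
        \<le> (\<integral>\<^sup>+ \<sigma>. ennreal (1 - ln s) * (g \<sigma> * ennreal ((1 - ln \<sigma>) powr (- 1)) * indicator {0<..<?h} \<sigma>) \<partial>lborel)"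
      proof (intro nn_integral_mono)
        fix \<sigma>
        show "epowr (decr_rearr M f0 \<sigma>) p * indicator {s<..<1} \<sigma>
          \<le> ennreal (1 - ln s) * (g \<sigma> * ennreal ((1 - ln \<sigma>) powr (- 1)) * indicator {0<..<?h} \<sigma>)"
        proof (cases "s < \<sigma> \<and> \<sigma> < ?h")
          case True
          have "ln s \<le> ln \<sigma>" "ln \<sigma> \<le> 0" using True s h by auto
          then have "1 \<le> (1 - ln s) * (1 - ln \<sigma>) powr (- 1)"
            by (simp add: powr_minus field_simps)
          then have "ennreal 1 * g \<sigma> \<le> ennreal ((1 - ln s) * (1 - ln \<sigma>) powr (- 1)) * g \<sigma>"
            by (intro mult_right_mono ennreal_leI) auto
          also have "\<dots> = ennreal (1 - ln s) * (g \<sigma> * ennreal ((1 - ln \<sigma>) powr (- 1)))"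
            using L by (subst ennreal_mult) (auto simp: mult_ac)
          finally show ?thesis
            using True s h r0[of \<sigma>] by (auto intro: order_trans)
        next
          case False
          then show ?thesis using z0[of \<sigma>] by (auto simp: indicator_def)
        qed
      qed
      also have "\<dots> = ennreal (1 - ln s) * ?A"
        unfolding head_integral_def by (intro nn_integral_cmult) measurable
      finally show "(\<integral>\<^sup>+ \<sigma> \<in> {s<..<1}. epowr (decr_rearr M f0 \<sigma>) p \<partial>lborel) \<le> ennreal (1 - ln s) * ?A" .
    qed
    have N1: "epowr (qnorm ?X1 f1) p \<le> ennreal ?h * g ?h + ?T"
    proof -
      have "epowr (qnorm ?X1 f1) p = (\<integral>\<^sup>+ \<sigma> \<in> {0<..<1}. epowr (decr_rearr M f1 \<sigma>) p \<partial>lborel)"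
        using one p by (intro epowr_qnorm_Lebesgue_space) auto
      also have "\<dots> \<le> (\<integral>\<^sup>+ \<sigma>. g ?h * indicator {0..?h} \<sigma> + g \<sigma> * indicator {?h<..<1} \<sigma> \<partial>lborel)"
        using r1 r1' by (intro nn_integral_mono) (auto simp: indicator_def)
      also have "\<dots> = (\<integral>\<^sup>+ \<sigma>. g ?h * indicator {0..?h} \<sigma> \<partial>lborel) + ?T"
        by (intro nn_integral_add) measurable
      also have "(\<integral>\<^sup>+ \<sigma>. g ?h * indicator {0..?h} \<sigma> \<partial>lborel) = ennreal ?h * g ?h"
        by (simp add: nn_integral_cmult_indicator mult.commute)
      finally show ?thesis .
    qed
    have gh: "g ?h < \<infinity>" unfolding g_def c(2) using c(1) by (simp add: epowr_ennreal)
    have "ennreal ?h * g ?h + ?T < \<infinity>"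
      using False gh by (auto simp: ennreal_mult_less_top less_top)
    with N1 have "epowr (qnorm ?X1 f1) p < \<infinity>"
      by (rule le_less_trans)
    then have "qnorm ?X1 f1 < \<infinity>"
      by (simp add: less_top[symmetric])
    moreover have "qnorm ?X0 f0 < \<infinity>"
      using False by (intro le_less_trans[OF N0]) (auto simp: less_top[symmetric])
    ultimately have d: "(f0, f1) \<in> decompositions M ?X0 ?X1 f"
      by (auto simp: decompositions_def elems_Lebesgue_space elems_grand_Lebesgue_space f0_def)
    have "K_functional M ?X0 ?X1 f t \<le> qnorm ?X0 f0 + ennreal t * qnorm ?X1 f1"
      unfolding K_functional_def using d by (rule INF_lower2) simp
    then have "epowr (K_functional M ?X0 ?X1 f t) p \<le> epowr (qnorm ?X0 f0 + ennreal t * qnorm ?X1 f1) p"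
      using p by (intro epowr_mono) auto
    also have "\<dots> \<le> ennreal (2 powr p) * (epowr (qnorm ?X0 f0) p + epowr (ennreal t * qnorm ?X1 f1) p)"
      using p by (intro epowr_add_le) auto
    also have "\<dots> \<le> ennreal (2 powr p) * (ennreal 5 * ?A + ennreal (t powr p) * ?T)"
    proof (intro mult_left_mono)
      have "epowr (qnorm ?X0 f0) p \<le> ?A"
        using p N0 by (subst epowr_le_iff) auto
      moreover have "epowr (ennreal t * qnorm ?X1 f1) p \<le> ennreal 4 * ?A + ennreal (t powr p) * ?T"
      proof -
        have "epowr (ennreal t * qnorm ?X1 f1) p = ennreal (t powr p) * epowr (qnorm ?X1 f1) p"
          using t by (simp add: epowr_mult epowr_ennreal)
        also have "\<dots> \<le> ennreal (t powr p) * (ennreal ?h * g ?h + ?T)"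
          using N1 by (intro mult_left_mono) auto
        also have "\<dots> = ennreal (?h * t powr p) * g ?h + ennreal (t powr p) * ?T"
          by (subst ennreal_mult) (auto simp: distrib_left mult_ac)
        also have "\<dots> \<le> ennreal 4 * ?A + ennreal (t powr p) * ?T"
          using t by (intro add_mono value_at_cut_le_head_integral p g) auto
        finally show ?thesis .
      qed
      ultimately have "epowr (qnorm ?X0 f0) p + epowr (ennreal t * qnorm ?X1 f1) p
        \<le> ?A + (ennreal 4 * ?A + ennreal (t powr p) * ?T)"
        by (rule add_mono)
      also have "\<dots> = ennreal 5 * ?A + ennreal (t powr p) * ?T"
      proof -
        have "ennreal 5 = 1 + ennreal 4"
          by (subst ennreal_1[symmetric], subst ennreal_plus[symmetric]) auto
        then show ?thesis by (simp only: distrib_right mult_1 add.assoc)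
      qed
      finally show "epowr (qnorm ?X0 f0) p + epowr (ennreal t * qnorm ?X1 f1) p
        \<le> ennreal 5 * ?A + ennreal (t powr p) * ?T" .
    qed auto
    finally show ?thesis .
  qed
qed

section \<open>Comparison of the quasinorms\<close>

lemma mono_K_functional: "mono (K_functional M X0 X1 f)"
proof (rule monoI)
  fix s t :: real assume "s \<le> t"
  then show "K_functional M X0 X1 f s \<le> K_functional M X0 X1 f t"
    unfolding K_functional_def
    by (intro INF_mono') (auto intro!: add_left_mono mult_right_mono ennreal_leI)
qed

text \<open>
  Here \<open>K\<close> stands for the K-functional. Its \<open>p\<close>-th power, rather than \<open>K\<close> itself, is compared with
  integrals of \<open>p\<close>-th powers of the rearrangement.
\<close>

lemma interp_integral_eq:
  assumes p: "0 < p"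
  shows "(\<integral>\<^sup>+ t \<in> {0<..<1}. epowr (ennreal (t powr (- \<theta>)) * K t) r * ennreal (1 / t) \<partial>lborel)
    = scale_integral (r * \<theta>) (r / p) (on_unit (\<lambda>t. epowr (K t) p))"
  unfolding scale_integral_def
proof (intro nn_integral_cong)
  fix t :: real
  show "epowr (ennreal (t powr (- \<theta>)) * K t) r * ennreal (1 / t) * indicator {0<..<1} t
    = ennreal (t powr (- (r * \<theta>) - 1)) *
        epowr (on_unit (\<lambda>t. epowr (K t) p) t) (r / p) * indicator {0<..} t"
  proof (cases "0 < t \<and> t < 1")
    case True
    have "ennreal (t powr (- (r * \<theta>) - 1)) = ennreal (t powr (- \<theta> * r)) * ennreal (1 / t)"
      using True by (subst ennreal_mult[symmetric]) (auto simp: powr_diff mult.commute)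
    moreover have "epowr (ennreal (t powr (- \<theta>)) * K t) r = ennreal (t powr (- \<theta> * r)) * epowr (K t) r"
      by (simp add: epowr_mult epowr_ennreal powr_powr)
    ultimately show ?thesis
      using True p by (simp add: on_unit_def epowr_epowr mult_ac)
  qed (auto simp: on_unit_def indicator_def)
qed

text \<open>
  Passing to larger parameters, the Hardy inequality needs \<open>(1 / 2) powr (r / p) * m powr (r * \<theta>) < 1\<close>,
  that is \<open>\<theta> < 1\<close>.
\<close>

lemma interp_le_head:
  assumes p: "0 < p" and r: "0 < r" and \<theta>: "\<theta> < 1" and one: "emeasure M (space M) = 1"
  obtains C where "0 < C"
    and "\<And>f. f \<in> borel_measurable M \<Longrightarrow>
      scale_integral (r * \<theta>) (r / p) (on_unit (\<lambda>t.
        epowr (K_functional M (grand_Lebesgue_space M p) (Lebesgue_space M p) f t) p))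
      \<le> ennreal C * scale_integral (r * \<theta>) (r / p)
        (on_unit (head_integral p (\<lambda>\<sigma>. epowr (decr_rearr M f \<sigma>) p)))"
proof -
  define m :: real where "m = 2 powr (1 / p)"
  have m0: "0 < m" by (simp add: m_def)
  have "(1 / 2) powr (r / p) * m powr (r * \<theta>) = 2 powr (- (r / p)) * 2 powr (r * \<theta> / p)"
    by (simp add: m_def powr_powr powr_divide powr_minus_divide)
  also have "\<dots> = 2 powr (r * (\<theta> - 1) / p)"
    unfolding powr_add[symmetric] by (simp add: diff_divide_distrib right_diff_distrib)
  also have "\<dots> < 2 powr 0"
    using p r \<theta> by (intro powr_less_mono) (auto simp: divide_neg_pos mult_pos_neg)
  finally have small: "(1 / 2) powr (r / p) * m powr (r * \<theta>) < 1" by simp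
  have q: "0 < r / p" and half: "(0::real) < 1 / 2" using p r by auto
  obtain C where C: "0 < C"
    and Hardy: "\<And>F G. G \<in> borel_measurable borel \<Longrightarrow>
      (\<And>t. 0 < t \<Longrightarrow> F t \<le> (\<Sum>k. ennreal ((1 / 2) ^ k) * G (m ^ k * t))) \<Longrightarrow>
      scale_integral (r * \<theta>) (r / p) F \<le> ennreal C * scale_integral (r * \<theta>) (r / p) G"
    using Hardy_dilation_sum[OF q m0 half small] by blast
  define D where "D = 2 powr p * (7 + 4 * exp 1 :: real)"
  have D: "0 < D" by (simp add: D_def add_pos_pos)
  show ?thesis
  proof (rule that)
    show "0 < C * D powr (r / p)" using C D by simp
    fix f :: "'a \<Rightarrow> real"
    assume f: "f \<in> borel_measurable M"
    let ?K = "K_functional M (grand_Lebesgue_space M p) (Lebesgue_space M p) f"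
    define g where "g = (\<lambda>\<sigma>. epowr (decr_rearr M f \<sigma>) p)"
    have g: "antimono g"
      unfolding g_def using p by (intro antimonoI epowr_mono decr_rearr_antimono) auto
    define A where "A = on_unit (head_integral p g)"
    have [measurable]: "A \<in> borel_measurable borel"
      unfolding A_def by measurable
    have "scale_integral (r * \<theta>) (r / p) (on_unit (\<lambda>t. epowr (?K t) p))
      \<le> ennreal C * scale_integral (r * \<theta>) (r / p) (\<lambda>t. ennreal D * A t)"
    proof (rule Hardy)
      fix t :: real assume t0: "0 < t"
      let ?S = "\<Sum>k. ennreal ((1 / 2) ^ k) * A (m ^ k * t)"
      show "on_unit (\<lambda>t. epowr (?K t) p) t \<le> (\<Sum>k. ennreal ((1 / 2) ^ k) * (ennreal D * A (m ^ k * t)))"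
      proof (cases "t < 1")
        case True
        have "epowr (?K t) p \<le> ennreal (2 powr p) * (ennreal 5 * head_integral p g t
            + ennreal (t powr p) * (\<integral>\<^sup>+ \<sigma> \<in> {log_cut p t<..<1}. g \<sigma> \<partial>lborel))"
          unfolding g_def by (rule K_functional_le_head_tail[OF p one f t0 True])
        also have "\<dots> \<le> ennreal (2 powr p) * (ennreal 5 * ?S + ennreal (2 + 4 * exp 1) * ?S)"
        proof (intro mult_left_mono add_mono)
          have "head_integral p g t = ennreal ((1 / 2) ^ 0) * A (m ^ 0 * t)"
            using t0 True by (simp add: A_def on_unit_def)
          also have "\<dots> \<le> ?S" by (rule suminf_ge_term)
          finally show "head_integral p g t \<le> ?S" .
          show "ennreal (t powr p) * (\<integral>\<^sup>+ \<sigma> \<in> {log_cut p t<..<1}. g \<sigma> \<partial>lborel) \<le> ennreal (2 + 4 * exp 1) * ?S"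
            unfolding A_def by (rule tail_integral_le_head_integrals[OF p m_def t0 True g])
        qed auto
        also have "\<dots> = ennreal D * ?S"
        proof -
          have "ennreal D = ennreal (2 powr p) * (ennreal 5 + ennreal (2 + 4 * exp 1))"
            by (subst ennreal_plus[symmetric], simp, simp, subst ennreal_mult[symmetric])
               (auto simp: D_def)
          then show ?thesis by (simp only: distrib_right mult.assoc)
        qed
        also have "\<dots> = (\<Sum>k. ennreal ((1 / 2) ^ k) * (ennreal D * A (m ^ k * t)))"
          by (simp only: mult.left_commute[of "ennreal ((1 / 2) ^ _)"] ennreal_suminf_cmult)
        finally show ?thesis using t0 True by (simp add: on_unit_def)
      qed (simp add: on_unit_def)
    qed measurable
    also have "\<dots> = ennreal (C * D powr (r / p)) * scale_integral (r * \<theta>) (r / p) A"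
      using C D by (simp add: scale_integral_cmult ennreal_mult mult.assoc)
    finally show "scale_integral (r * \<theta>) (r / p) (on_unit (\<lambda>t. epowr (?K t) p))
      \<le> ennreal (C * D powr (r / p)) * scale_integral (r * \<theta>) (r / p)
        (on_unit (head_integral p (\<lambda>\<sigma>. epowr (decr_rearr M f \<sigma>) p)))"
      by (simp add: A_def g_def)
  qed
qed

text \<open>
  Passing to smaller parameters with constant coefficients, the Hardy inequality needs \<open>\<theta> > 0\<close>.
\<close>

lemma head_le_interp:
  assumes p: "0 < p" and r: "0 < r" and \<theta>: "0 < \<theta>" and one: "emeasure M (space M) = 1"
  obtains C where "0 < C"
    and "\<And>f. f \<in> borel_measurable M \<Longrightarrow>
      scale_integral (r * \<theta>) (r / p) (on_unit (head_integral p (\<lambda>\<sigma>. epowr (decr_rearr M f \<sigma>) p)))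
      \<le> ennreal C * scale_integral (r * \<theta>) (r / p) (on_unit (\<lambda>t.
        epowr (K_functional M (grand_Lebesgue_space M p) (Lebesgue_space M p) f t) p))"
proof -
  define m :: real where "m = 2 powr (1 / p)"
  have m1: "1 < m" using p by (simp add: m_def)
  have "1 < m powr (r * \<theta>)" using m1 r \<theta> by (intro gr_one_powr) auto
  then have small: "1 powr (r / p) * (1 / m) powr (r * \<theta>) < 1"
    using m1 by (simp add: powr_divide)
  have q: "0 < r / p" and m0: "0 < 1 / m" using p r m1 by auto
  obtain C where C: "0 < C"
    and Hardy: "\<And>F G. G \<in> borel_measurable borel \<Longrightarrow>
      (\<And>t. 0 < t \<Longrightarrow> F t \<le> (\<Sum>k. ennreal (1 ^ k) * G ((1 / m) ^ k * t))) \<Longrightarrow>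
      scale_integral (r * \<theta>) (r / p) F \<le> ennreal C * scale_integral (r * \<theta>) (r / p) G"
    using Hardy_dilation_sum[OF q m0 zero_less_one small] by blast
  define D :: real where "D = 10 * 2 powr p"
  have D: "0 < D" by (simp add: D_def)
  show ?thesis
  proof (rule that)
    show "0 < C * D powr (r / p)" using C D by simp
    fix f :: "'a \<Rightarrow> real"
    assume f: "f \<in> borel_measurable M"
    let ?K = "K_functional M (grand_Lebesgue_space M p) (Lebesgue_space M p) f"
    define g where "g = (\<lambda>\<sigma>. epowr (decr_rearr M f \<sigma>) p)"
    have [measurable]: "g \<in> borel_measurable borel"
      unfolding g_def by measurable
    define K where "K = on_unit (\<lambda>t. epowr (?K t) p)"
    note [measurable] = borel_measurable_mono_ennreal[OF mono_K_functional]
    have [measurable]: "K \<in> borel_measurable borel"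
      unfolding K_def on_unit_def[abs_def] by measurable
    have "scale_integral (r * \<theta>) (r / p) (on_unit (head_integral p g))
      \<le> ennreal C * scale_integral (r * \<theta>) (r / p) (\<lambda>t. ennreal D * K t)"
    proof (rule Hardy)
      fix t :: real assume t0: "0 < t"
      show "on_unit (head_integral p g) t \<le> (\<Sum>k. ennreal (1 ^ k) * (ennreal D * K ((1 / m) ^ k * t)))"
      proof (cases "t < 1")
        case True
        let ?l = "\<lambda>k. (1 / m) ^ k * t"
        have l: "0 < ?l k" "?l k < 1" for k
        proof -
          have "(1 / m) ^ k \<le> 1" using m1 by (intro power_le_one) auto
          then have "?l k \<le> 1 * t" using t0 by (intro mult_right_mono) auto
          then show "?l k < 1" using True by simp
          show "0 < ?l k" using m1 t0 by simp
        qed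
        have "head_integral p g t \<le> (\<Sum>k. ennreal (?l k powr p) *
            (\<integral>\<^sup>+ \<sigma> \<in> {log_cut p (?l k / m)<..log_cut p (?l k)}. g \<sigma> \<partial>lborel))"
          using True by (intro head_integral_le_block_sum p m1 t0) auto
        also have "\<dots> \<le> (\<Sum>k. ennreal (1 ^ k) * (ennreal D * K (?l k)))"
        proof (intro suminf_le)
          fix k
          have "ennreal (?l k powr p) * (\<integral>\<^sup>+ \<sigma> \<in> {log_cut p (?l k / m)<..log_cut p (?l k)}. g \<sigma> \<partial>lborel)
            \<le> ennreal D * epowr (?K (?l k)) p"
            unfolding D_def m_def g_def
            by (rule block_le_K_functional[OF p one f l[unfolded m_def]])
          then show "ennreal (?l k powr p) * (\<integral>\<^sup>+ \<sigma> \<in> {log_cut p (?l k / m)<..log_cut p (?l k)}. g \<sigma> \<partial>lborel)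
            \<le> ennreal (1 ^ k) * (ennreal D * K (?l k))"
            unfolding K_def on_unit_def using l[of k] by simp
        qed auto
        finally show ?thesis using t0 True by (simp add: on_unit_def)
      qed (simp add: on_unit_def)
    qed measurable
    also have "\<dots> = ennreal (C * D powr (r / p)) * scale_integral (r * \<theta>) (r / p) K"
      using C D by (simp add: scale_integral_cmult ennreal_mult mult.assoc)
    finally show "scale_integral (r * \<theta>) (r / p) (on_unit (head_integral p (\<lambda>\<sigma>. epowr (decr_rearr M f \<sigma>) p)))
      \<le> ennreal (C * D powr (r / p)) * scale_integral (r * \<theta>) (r / p) (on_unit (\<lambda>t. epowr (?K t) p))"
      by (simp add: K_def g_def)
  qed
qed

text \<open>
  Without a decomposition the K-functional is the infimum of the empty set, hence infinite.
\<close>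

lemma in_sum_space_if_interp_finite:
  assumes f: "f \<in> borel_measurable M" and fin: "interp_qnorm M X0 X1 \<theta> r f < \<infinity>"
  shows "f \<in> sum_space M X0 X1"
proof (rule ccontr)
  assume "f \<notin> sum_space M X0 X1"
  then have empty: "decompositions M X0 X1 f = {}"
    using f by (simp add: sum_space_def)
  have "K_functional M X0 X1 f t = \<infinity>" for t
    by (simp add: K_functional_def empty)
  then have "interp_qnorm M X0 X1 \<theta> r f = epowr (\<integral>\<^sup>+ t. \<infinity> * indicator {0<..<1::real} t \<partial>lborel) (1 / r)"
    unfolding interp_qnorm_def
    by (intro arg_cong[where f = "\<lambda>x. epowr x (1 / r)"] nn_integral_cong)
       (auto simp: indicator_def ennreal_mult_top ennreal_top_mult)
  also have "\<dots> = \<infinity>"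
    by (subst nn_integral_cmult_indicator) (auto simp: ennreal_top_mult)
  finally show False using fin by simp
qed

text \<open>
  The two integral comparisons hold for all measurable functions, whether or not the integrals are
  finite; therefore they give not only the equivalence of the quasinorms but also the equality of the
  two sets.
\<close>

lemma interp_grand_Lebesgue_Lebesgue:
  fixes M :: "'a measure"
  assumes one: "emeasure M (space M) = 1"
    and p: "0 < p" and \<theta>: "0 < \<theta>" "\<theta> < 1" and r: "0 < r"
  shows "eq_equiv_qnorms
    (interp_space M (grand_Lebesgue_space M p) (Lebesgue_space M p) \<theta> r)
    (GGamma_space M p r
       (\<lambda>t. t powr (- 1) * (1 - ln t) powr (r * \<theta> / p - 1))
       (\<lambda>t. (1 - ln t) powr (- 1)))"
proof -
  let ?X = "interp_space M (grand_Lebesgue_space M p) (Lebesgue_space M p) \<theta> r"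
  let ?Y = "GGamma_space M p r (\<lambda>t. t powr (- 1) * (1 - ln t) powr (r * \<theta> / p - 1)) (\<lambda>t. (1 - ln t) powr (- 1))"
  let ?I = "\<lambda>f. scale_integral (r * \<theta>) (r / p) (on_unit (\<lambda>t.
    epowr (K_functional M (grand_Lebesgue_space M p) (Lebesgue_space M p) f t) p))"
  let ?J = "\<lambda>f. scale_integral (r * \<theta>) (r / p)
    (on_unit (head_integral p (\<lambda>\<sigma>. epowr (decr_rearr M f \<sigma>) p)))"
  have X: "qnorm ?X f = epowr (?I f) (1 / r)" for f
    unfolding interp_integral_eq[OF p, symmetric] by (simp add: interp_space_def interp_qnorm_def)
  have Y: "qnorm ?Y f = ennreal (p powr (1 / r)) * epowr (?J f) (1 / r)" for f
  proof -
    have "qnorm ?Y f = epowr (ennreal p * ?J f) (1 / r)"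
      unfolding GGamma_integral_eq[OF p, symmetric] by (simp add: GGamma_space_def space_of_qnorm_def)
    then show ?thesis using p by (simp add: epowr_mult epowr_ennreal)
  qed
  obtain C where C: "0 < C" "\<And>f. f \<in> borel_measurable M \<Longrightarrow> ?I f \<le> ennreal C * ?J f"
    using interp_le_head[OF p r \<theta>(2) one] by blast
  obtain D where D: "0 < D" "\<And>f. f \<in> borel_measurable M \<Longrightarrow> ?J f \<le> ennreal D * ?I f"
    using head_le_interp[OF p r \<theta>(1) one] by blast
  \<comment> \<open>The factor \<open>p\<close> is the Jacobian in \<open>GGamma_integral_eq\<close>.\<close>
  define c' where "c' = p powr (1 / r) * D powr (1 / r)"
  define C' where "C' = C powr (1 / r) / p powr (1 / r)"
  have pos: "0 < c'" "0 < C'" using p C D by (auto simp: c'_def C'_def)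
  have XY: "qnorm ?X f \<le> ennreal C' * qnorm ?Y f" if f: "f \<in> borel_measurable M" for f
  proof -
    have "qnorm ?X f \<le> epowr (ennreal C * ?J f) (1 / r)"
      unfolding X using r by (intro epowr_mono C(2)[OF f]) auto
    also have "\<dots> = ennreal (C powr (1 / r)) * epowr (?J f) (1 / r)"
      using C(1) by (simp add: epowr_mult epowr_ennreal)
    also have "C powr (1 / r) = C' * p powr (1 / r)" using p by (simp add: C'_def)
    also have "ennreal (C' * p powr (1 / r)) * epowr (?J f) (1 / r) = ennreal C' * qnorm ?Y f"
      unfolding Y using pos by (simp add: ennreal_mult mult.assoc)
    finally show ?thesis .
  qed
  have YX: "qnorm ?Y f \<le> ennreal c' * qnorm ?X f" if f: "f \<in> borel_measurable M" for f
  proof -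
    have "epowr (?J f) (1 / r) \<le> epowr (ennreal D * ?I f) (1 / r)"
      using r by (intro epowr_mono D(2)[OF f]) auto
    also have "\<dots> = ennreal (D powr (1 / r)) * qnorm ?X f"
      unfolding X using D(1) by (simp add: epowr_mult epowr_ennreal)
    finally have "qnorm ?Y f \<le> ennreal (p powr (1 / r)) * (ennreal (D powr (1 / r)) * qnorm ?X f)"
      unfolding Y by (intro mult_left_mono) auto
    then show ?thesis by (simp add: c'_def ennreal_mult mult.assoc)
  qed
  have "elems ?X = elems ?Y"
  proof (intro equalityI subsetI)
    fix f assume f: "f \<in> elems ?X"
    then have [measurable]: "f \<in> borel_measurable M" and fin: "qnorm ?X f < \<infinity>"
      by (auto simp: interp_space_def sum_space_def)
    have "qnorm ?Y f < \<infinity>"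
      using fin by (intro le_less_trans[OF YX]) (auto simp: ennreal_mult_less_top)
    then show "f \<in> elems ?Y"
      by (simp add: GGamma_space_def space_of_qnorm_def)
  next
    fix f assume f: "f \<in> elems ?Y"
    then have [measurable]: "f \<in> borel_measurable M" and fin: "qnorm ?Y f < \<infinity>"
      by (auto simp: GGamma_space_def space_of_qnorm_def)
    have "qnorm ?X f < \<infinity>"
      using fin by (intro le_less_trans[OF XY]) (auto simp: ennreal_mult_less_top)
    then show "f \<in> elems ?X"
      by (auto simp: interp_space_def intro: in_sum_space_if_interp_finite)
  qed
  moreover have "ennreal (1 / c') * qnorm ?Y f \<le> qnorm ?X f \<and> qnorm ?X f \<le> ennreal C' * qnorm ?Y f"
    if "f \<in> elems ?X" for f
  proof -
    have f: "f \<in> borel_measurable M"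
      using that by (auto simp: interp_space_def sum_space_def)
    have "ennreal (1 / c') * qnorm ?Y f \<le> ennreal (1 / c') * (ennreal c' * qnorm ?X f)"
      by (intro mult_left_mono YX f) auto
    also have "\<dots> = qnorm ?X f"
      using pos by (simp only: mult.assoc[symmetric], subst ennreal_mult[symmetric]) auto
    finally show ?thesis using XY[OF f] by blast
  qed
  ultimately show ?thesis
    unfolding eq_equiv_qnorms_def using pos
    by (intro conjI exI[of _ "1 / c'"] exI[of _ C']) auto
qed

theorem theorem3p4:
  fixes \<Omega> :: "(real ^ 'n) set" and p \<theta> r :: real
  assumes "open \<Omega>" and "bounded \<Omega>" and "emeasure lebesgue \<Omega> = 1"
    and "1 < p" and "0 < \<theta>" and "\<theta> < 1" and "1 \<le> r"
  shows "eq_equiv_qnorms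
    (interp_space (lebesgue_on \<Omega>)
       (grand_Lebesgue_space (lebesgue_on \<Omega>) p) (Lebesgue_space (lebesgue_on \<Omega>) p) \<theta> r)
    (GGamma_space (lebesgue_on \<Omega>) p r
       (\<lambda>t. t powr (- 1) * (1 - ln t) powr (r * \<theta> / p - 1))
       (\<lambda>t. (1 - ln t) powr (- 1)))"
proof (rule interp_grand_Lebesgue_Lebesgue)
  have "\<Omega> \<in> sets lebesgue"
    using \<open>open \<Omega>\<close> by auto
  then show "emeasure (lebesgue_on \<Omega>) (space (lebesgue_on \<Omega>)) = 1"
    using assms(3) by (simp add: emeasure_restrict_space)
qed (use assms in auto)

end
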